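(* Let $n\ge 1$, let $X\subset\mathbb{C}$ be a connected neighborhood of $0$, and let $J:\mathbb{C}^{n}\to \mathrm{GL}(2n,\mathbb{R})$ be a $C^{1}$ function with $J^{2}=-I$ (that is, $J(p)^2=-I$ for every $p\in\mathbb{C}^n$). Suppose $u,v\in C^{\infty}(X,\mathbb{C}^{n})$ satisfy $$\partial_{x_{1}}u+J(u)\,\partial_{x_{2}}u=0\quad\text{and}\quad \partial_{x_{1}}v+J(v)\,\partial_{x_{2}}v=0\quad\text{in } X.$$ If $u-v$ vanishes to infinite order at $0$, then $u=v$ in $X$.
   Context: Points of $X\subset\mathbb{C}$ are written $x=x_{1}+ix_{2}$ with $x_1,x_2\in\mathbb{R}$, and $\partial_{x_1},\partial_{x_2}$ denote the corresponding real partial derivatives. The space $\mathbb{C}^n$ is identified with $\mathbb{R}^{2n}$, so that $J(u(x))\in \mathrm{GL}(2n,\mathbb{R})$ acts on $\partial_{x_2}u(x)\in\mathbb{C}^n\cong\mathbb{R}^{2n}$ by matrix multiplication. Neighborhoods are understood to be open. A smooth function $w$ vanishes to infinite order at $0$ if for every $N$ there exists a constant $C_N$ such that $|w(x)|\le C_N|x|^N$ in a neighborhood of $0$. *)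

theory Defs
  imports "HOL-Analysis.Analysis"
begin

text \<open>
  \<open>C_diff_on k f S\<close>: on the open set \<open>S\<close>, \<open>f\<close> is of class \<open>C\<^sup>k\<close> over the reals.
  The recursion goes through the directional derivatives \<open>x \<mapsto> Df(x) h\<close>; since the domain is
  finite-dimensional, this is the same as recursing on \<open>x \<mapsto> Df(x)\<close> with the operator norm,
  but stays within one function type. As \<open>frechet_derivative\<close> and \<open>at x\<close> are not relativised
  to \<open>S\<close>, the notion is only meant for open \<open>S\<close>.
\<close>

primrec C_diff_on ::
    "nat \<Rightarrow> ('a::euclidean_space \<Rightarrow> 'b::real_normed_vector) \<Rightarrow> 'a set \<Rightarrow> bool" where
  "C_diff_on 0 f S \<longleftrightarrow> continuous_on S f"
| "C_diff_on (Suc k) f S \<longleftrightarrow>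
     (\<forall>x\<in>S. f differentiable (at x)) \<and>
     (\<forall>h. C_diff_on k (\<lambda>x. frechet_derivative f (at x) h) S)"

definition smooth_on :: "('a::euclidean_space \<Rightarrow> 'b::real_normed_vector) \<Rightarrow> 'a set \<Rightarrow> bool" where
  "smooth_on f S \<longleftrightarrow> (\<forall>k. C_diff_on k f S)"

definition partial_x1 :: "(complex \<Rightarrow> 'b::real_normed_vector) \<Rightarrow> complex \<Rightarrow> 'b" where
  "partial_x1 f x = vector_derivative (\<lambda>t. f (Complex t (Im x))) (at (Re x))"

definition partial_x2 :: "(complex \<Rightarrow> 'b::real_normed_vector) \<Rightarrow> complex \<Rightarrow> 'b" where
  "partial_x2 f x = vector_derivative (\<lambda>t. f (Complex (Re x) t)) (at (Im x))"

text \<open>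
  The identification of \<open>\<complex>\<^sup>n\<close> with \<open>\<real>\<^sup>2\<^sup>n\<close>: the index type \<open>'n + 'n\<close> has \<open>2n\<close> elements, the left
  summand indexing the real parts and the right summand the imaginary parts.
\<close>

definition to_real_vec :: "complex ^ 'n \<Rightarrow> real ^ ('n + 'n)" where
  "to_real_vec z = (\<chi> k. case k of Inl i \<Rightarrow> Re (z $ i) | Inr i \<Rightarrow> Im (z $ i))"

definition of_real_vec :: "real ^ ('n + 'n) \<Rightarrow> complex ^ 'n" where
  "of_real_vec y = (\<chi> i. Complex (y $ Inl i) (y $ Inr i))"

lemma of_real_vec_to_real_vec [simp]: "of_real_vec (to_real_vec z) = z"
  by (simp add: of_real_vec_def to_real_vec_def vec_eq_iff)

lemma to_real_vec_of_real_vec [simp]: "to_real_vec (of_real_vec y) = y"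
  by (auto simp: of_real_vec_def to_real_vec_def vec_eq_iff split: sum.split)

definition real_matrix_act ::
    "real ^ ('n::finite + 'n) ^ ('n + 'n) \<Rightarrow> complex ^ 'n \<Rightarrow> complex ^ 'n" where
  "real_matrix_act A z = of_real_vec (A *v to_real_vec z)"

definition vanishes_to_infinite_order_at_0 ::
    "('a::real_normed_vector \<Rightarrow> 'b::real_normed_vector) \<Rightarrow> bool" where
  "vanishes_to_infinite_order_at_0 w \<longleftrightarrow>
     (\<forall>N::nat. \<exists>C::real. \<forall>\<^sub>F x in nhds 0. norm (w x) \<le> C * norm x ^ N)"

end

theory Submission
  imports Defs
begin

text \<open>
  Put \<open>w = u - v\<close> and \<open>A x = J (u x)\<close>. Since \<open>J\<close> is locally Lipschitz, subtracting the two equations gives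
  \<open>\<bar>\<partial>\<^sub>1 w + A \<partial>\<^sub>2 w\<bar> \<le> L \<bar>w\<bar>\<close> on every closed disc in \<open>X\<close>, with \<open>A\<close> of class \<open>C\<^sup>1\<close> and \<open>A\<^sup>2 = -1\<close>. It remains to
  prove strong unique continuation for this linear inequality (\<open>unique_continuation\<close>). One works with
  the first-order system: passing to the Laplacian of \<open>u - v\<close> would bring in differences of the derivative
  of \<open>J\<close>, which is merely continuous.

  The proof is a frequency function argument. In polar coordinates with \<open>t = ln r\<close> the inequality becomes
  \<open>W\<^sub>t + B W\<^sub>\<theta> = O(e\<^sup>t \<bar>W\<bar>)\<close>, where \<open>B\<close> is \<open>A\<close> in these coordinates. The operator \<open>B \<partial>\<^sub>\<theta>\<close> on circles is
  symmetric, up to an error \<open>O(e\<^sup>t)\<close>, for the inner product \<open>x \<bullet> y + B x \<bullet> B y\<close>, and it varies with \<open>t\<close> at the relative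
  rate \<open>O(e\<^sup>t)\<close>. Let \<open>H(t)\<close> be the squared norm of \<open>W\<close> on the circle, \<open>D(t)\<close> the quadratic form of \<open>B \<partial>\<^sub>\<theta>\<close> at \<open>W\<close>,
  and \<open>N = D / H\<close>. If all errors vanished, \<open>H' = -2 D\<close>, and the Cauchy-Schwarz inequality would make \<open>N\<close>
  nonincreasing. With the errors, \<open>N' \<le> c e\<^sup>t (1 + \<bar>N\<bar>)\<close> (\<open>frequency_density_le\<close>). Since \<open>e\<^sup>t\<close> is
  integrable at \<open>-\<infinity>\<close>, the rate \<open>-N\<close> is bounded above as \<open>t \<rightarrow> -\<infinity>\<close>, whence \<open>H(t) \<ge> H(t\<^sub>0) e\<^sup>K\<^sup>(\<^sup>t\<^sup>-\<^sup>t\<^sup>0\<^sup>)\<close> for some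
  \<open>K\<close> (\<open>exponential_lower_bound\<close>). A function vanishing to infinite order cannot satisfy this unless
  \<open>H(t\<^sub>0) = 0\<close>. So \<open>w\<close> vanishes on each disc in \<open>X\<close> around a point of flatness, and connectedness of \<open>X\<close> spreads
  this to all of \<open>X\<close>.
\<close>

section \<open>Two differential inequalities on a half-line\<close>

text \<open>
  Here \<open>H\<close> plays the role of a squared norm, \<open>D\<close> of a quadratic form and \<open>N = D / H\<close> of a Rayleigh
  quotient (frequency). The second differential inequality says \<open>N' \<le> c e\<^sup>t (1 + \<bar>N\<bar>)\<close>. As
  \<open>1 + \<bar>N\<bar> \<le> 2 \<surd>(1 + N\<^sup>2)\<close> and \<open>1 / \<surd>(1 + N\<^sup>2)\<close> is the derivative of \<open>arsinh\<close>, the function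
  \<open>arsinh (-N) + 2 c e\<^sup>t\<close> is nondecreasing, whatever the sign of \<open>N\<close>. So \<open>-N\<close> stays bounded above
  backwards in time, because \<open>e\<^sup>t\<close> is integrable at \<open>-\<infinity>\<close>, and then the first inequality
  bounds the logarithmic growth rate of \<open>H\<close>. The point is that \<open>K\<close> does not depend on \<open>a\<close>.
\<close>
lemma exponential_lower_bound_while_positive:
  fixes H D H' D' :: "real \<Rightarrow> real"
  assumes "0 \<le> c"
    and H_deriv: "\<And>t. t < T \<Longrightarrow> (H has_real_derivative H' t) (at t)"
    and D_deriv: "\<And>t. t < T \<Longrightarrow> (D has_real_derivative D' t) (at t)"
    and H'_le: "\<And>t. t < T \<Longrightarrow> H' t \<le> - 2 * D t + c * exp t * H t"
    and D'_le: "\<And>t. t < T \<Longrightarrow> H t > 0 \<Longrightarrow>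
                  D' t - D t / H t * H' t \<le> c * exp t * (1 + \<bar>D t / H t\<bar>) * H t"
    and "t0 < T"
  shows "\<exists>K. \<forall>a\<le>t0. (\<forall>t\<in>{a..t0}. H t > 0) \<longrightarrow> H t0 * exp (K * (a - t0)) \<le> H a"
proof -
  define N where "N t = D t / H t" for t
  define \<phi> where "\<phi> t = arsinh (- N t) + 2 * c * exp t" for t
  define K where "K = 2 * sinh (\<phi> t0) + c * exp T"
  have "H t0 * exp (K * (a - t0)) \<le> H a" if "a \<le> t0" and pos: "\<forall>t\<in>{a..t0}. H t > 0" for a
  proof -
    have \<phi>_deriv: "\<exists>y. (\<phi> has_real_derivative y) (at t) \<and> 0 \<le> y" if t: "a \<le> t" "t \<le> t0" for t
    proof -
      have Ht: "H t > 0" and tT: "t < T" using pos t \<open>t0 < T\<close> by auto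
      define y where "y = (D' t - N t * H' t) / H t"
      have N_deriv: "(N has_real_derivative y) (at t)"
      proof -
        have "((\<lambda>t. D t / H t) has_real_derivative
                (D' t * H t - D t * H' t) / (H t * H t)) (at t)"
          using DERIV_divide[OF D_deriv[OF tT] H_deriv[OF tT]] Ht by simp
        moreover have "(D' t * H t - D t * H' t) / (H t * H t) = y"
          using Ht by (simp add: y_def N_def field_simps)
        moreover have "N = (\<lambda>t. D t / H t)" by (auto simp: N_def)
        ultimately show ?thesis by simp
      qed
      have y_le: "y \<le> c * exp t * (1 + \<bar>N t\<bar>)"
        using D'_le[OF tT Ht] Ht by (simp add: y_def N_def pos_divide_le_eq)
      have s: "1 + \<bar>N t\<bar> \<le> 2 * sqrt ((N t)\<^sup>2 + 1)"
      proof -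
        have "1 \<le> sqrt ((N t)\<^sup>2 + 1)" by simp
        moreover have "\<bar>N t\<bar> \<le> sqrt ((N t)\<^sup>2 + 1)" by (rule real_le_rsqrt) simp
        ultimately show ?thesis by linarith
      qed
      have sp: "sqrt ((N t)\<^sup>2 + 1) > 0"
        by (smt (verit) real_sqrt_gt_zero zero_le_power2)
      have "(\<phi> has_real_derivative
              1 / sqrt ((- N t)\<^sup>2 + 1) * (- y) + 2 * c * exp t) (at t)"
        unfolding \<phi>_def
        by (intro DERIV_add DERIV_chain2[OF arsinh_real_has_field_derivative] DERIV_minus N_deriv
            DERIV_cmult DERIV_exp)
      moreover have "y / sqrt ((N t)\<^sup>2 + 1) \<le> 2 * c * exp t"
      proof -
        have "y \<le> c * exp t * (2 * sqrt ((N t)\<^sup>2 + 1))"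
          using y_le mult_left_mono[OF s, of "c * exp t"] \<open>0 \<le> c\<close> by simp
        then show ?thesis using sp by (simp add: pos_divide_le_eq mult_ac)
      qed
      ultimately show ?thesis by (intro exI[of _ "1 / sqrt ((- N t)\<^sup>2 + 1) * (- y) + 2 * c * exp t"]) auto
    qed
    have N_ge: "- N t \<le> sinh (\<phi> t0)" if "a \<le> t" "t \<le> t0" for t
    proof -
      have "\<phi> t \<le> \<phi> t0"
        by (rule DERIV_nonneg_imp_nondecreasing[OF that(2)]) (use \<phi>_deriv that in auto)
      then have "arsinh (- N t) \<le> \<phi> t0"
        using \<open>0 \<le> c\<close> by (simp add: \<phi>_def[of t]) (smt (verit) exp_ge_zero mult_nonneg_nonneg)
      then have "sinh (arsinh (- N t)) \<le> sinh (\<phi> t0)" by (simp only: sinh_real_le_iff)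
      then show ?thesis by (simp only: sinh_arsinh_real)
    qed
    have H'_le_K: "H' t \<le> K * H t" if t: "a \<le> t" "t \<le> t0" for t
    proof -
      have Ht: "H t > 0" and tT: "t < T" using pos t \<open>t0 < T\<close> by auto
      have "- 2 * D t = 2 * (- N t) * H t" using Ht by (simp add: N_def)
      also have "\<dots> \<le> 2 * sinh (\<phi> t0) * H t" using N_ge[OF t] Ht by (intro mult_right_mono mult_left_mono) auto
      finally have "- 2 * D t \<le> 2 * sinh (\<phi> t0) * H t" .
      moreover have "c * exp t * H t \<le> c * exp T * H t"
        using tT Ht \<open>0 \<le> c\<close> by (intro mult_right_mono mult_left_mono) auto
      ultimately show ?thesis using H'_le[OF tT] unfolding K_def distrib_right by linarith
    qed
    have "H t0 * exp (- K * t0) \<le> H a * exp (- K * a)"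
    proof (rule DERIV_nonpos_imp_nonincreasing[OF \<open>a \<le> t0\<close>])
      fix t assume t: "a \<le> t" "t \<le> t0"
      have "((\<lambda>t. H t * exp (- K * t)) has_real_derivative
              (H' t - K * H t) * exp (- K * t)) (at t)"
        using t \<open>t0 < T\<close>
        by (auto intro!: derivative_eq_intros H_deriv simp: algebra_simps)
      moreover have "(H' t - K * H t) * exp (- K * t) \<le> 0"
        using H'_le_K[OF t] by (simp add: mult_nonpos_nonneg)
      ultimately show "\<exists>y. ((\<lambda>t. H t * exp (- K * t)) has_real_derivative y) (at t) \<and> y \<le> 0"
        by blast
    qed
    then have "H t0 * exp (- K * t0) * exp (K * a) \<le> H a * exp (- K * a) * exp (K * a)"
      by (intro mult_right_mono) auto
    then show ?thesis by (simp add: mult.assoc exp_add[symmetric] algebra_simps)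
  qed
  then show ?thesis by blast
qed

text \<open>
  Positivity on all of \<open>(-\<infinity>, t\<^sub>0]\<close> comes for free: at the last zero \<open>s\<close> of \<open>H\<close> before \<open>t\<^sub>0\<close>, the
  exponential lower bound on \<open>(s, t\<^sub>0]\<close> would pass to the limit.
\<close>
lemma exponential_lower_bound:
  fixes H D H' D' :: "real \<Rightarrow> real"
  assumes "0 \<le> c"
    and H_deriv: "\<And>t. t < T \<Longrightarrow> (H has_real_derivative H' t) (at t)"
    and D_deriv: "\<And>t. t < T \<Longrightarrow> (D has_real_derivative D' t) (at t)"
    and H_nonneg: "\<And>t. t < T \<Longrightarrow> 0 \<le> H t"
    and H'_le: "\<And>t. t < T \<Longrightarrow> H' t \<le> - 2 * D t + c * exp t * H t"
    and D'_le: "\<And>t. t < T \<Longrightarrow> H t > 0 \<Longrightarrow>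
                  D' t - D t / H t * H' t \<le> c * exp t * (1 + \<bar>D t / H t\<bar>) * H t"
    and "t0 < T" and "H t0 > 0"
  shows "\<exists>K. \<forall>a\<le>t0. H t0 * exp (K * (a - t0)) \<le> H a"
proof -
  obtain K where K: "\<And>a. a \<le> t0 \<Longrightarrow> (\<forall>t\<in>{a..t0}. H t > 0) \<Longrightarrow> H t0 * exp (K * (a - t0)) \<le> H a"
    using exponential_lower_bound_while_positive[OF \<open>0 \<le> c\<close> H_deriv D_deriv H'_le D'_le \<open>t0 < T\<close>]
    by blast
  have pos: "H a > 0" if "a \<le> t0" for a
  proof (rule ccontr)
    assume "\<not> H a > 0"
    then have Ha: "H a = 0" using H_nonneg[of a] that \<open>t0 < T\<close> by auto
    have cont: "continuous_on {a..t0} H"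
      using H_deriv \<open>t0 < T\<close>
      by (intro continuous_at_imp_continuous_on ballI DERIV_isCont[OF H_deriv]) auto
    define Z where "Z = {t \<in> {a..t0}. H t = 0}"
    have "compact Z"
      unfolding Z_def using continuous_closed_preimage_constant[OF cont, of 0]
      by (auto simp: compact_eq_bounded_closed intro: bounded_subset[of "{a..t0}"])
    moreover have "a \<in> Z" using Ha that by (auto simp: Z_def)
    ultimately obtain s where s: "s \<in> Z" "\<And>t. t \<in> Z \<Longrightarrow> t \<le> s"
      using compact_attains_sup[of Z] by blast
    have sa: "a \<le> s" "s < t0" "H s = 0"
      using s(1) \<open>H t0 > 0\<close> by (auto simp: Z_def less_le)
    have lower: "H t0 * exp (K * (t - t0)) \<le> H t" if "s < t" "t \<le> t0" for t
    proof (rule K[OF that(2)], rule ballI)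
      fix r assume r: "r \<in> {t..t0}"
      then have "r \<notin> Z" using s(2)[of r] that by auto
      then show "H r > 0" using r that sa H_nonneg[of r] \<open>t0 < T\<close> by (auto simp: Z_def less_le)
    qed
    have "H t0 * exp (K * (s - t0)) \<le> H s"
    proof (rule tendsto_le)
      show "at_right s \<noteq> bot" by simp
      show "((\<lambda>t. H t0 * exp (K * (t - t0))) \<longlongrightarrow> H t0 * exp (K * (s - t0))) (at_right s)"
        by (auto intro!: tendsto_intros)
      show "(H \<longlongrightarrow> H s) (at_right s)"
        using DERIV_isCont[OF H_deriv[of s]] sa \<open>t0 < T\<close>
        by (auto simp: isCont_def filterlim_at_split)
      show "\<forall>\<^sub>F t in at_right s. H t0 * exp (K * (t - t0)) \<le> H t"
        using eventually_at_right_less[of s] eventually_at_right_field sa(2) lower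
        by (auto simp: eventually_at_right_field intro!: exI[of _ t0])
    qed
    then show False using \<open>H t0 > 0\<close> sa by (simp add: mult_le_0_iff not_le)
  qed
  show ?thesis using K pos by force
qed

section \<open>Pointwise estimates for an adapted inner product\<close>

text \<open>
  When \<open>B\<^sup>2 = -1\<close>, this is an inner product for which \<open>B\<close> is both isometric and skew, so that the
  operator \<open>B \<partial>\<^sub>\<theta>\<close> on a circle is formally symmetric up to terms containing derivatives of \<open>B\<close>.
\<close>
definition adapted_inner :: "('b::real_inner \<Rightarrow>\<^sub>L 'b) \<Rightarrow> 'b \<Rightarrow> 'b \<Rightarrow> real" where
  "adapted_inner B x y = inner x y + inner (B x) (B y)"

lemma adapted_inner_nonneg: "0 \<le> adapted_inner B x x"
  by (simp add: adapted_inner_def)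

lemma norm_le_sqrt_adapted_inner:
  "norm x \<le> sqrt (adapted_inner B x x)" "norm (B x) \<le> sqrt (adapted_inner B x x)"
  by (auto simp: adapted_inner_def power2_norm_eq_inner intro!: real_le_rsqrt)

text \<open>
  In the next two lemmas \<open>wt\<close>, \<open>ws\<close>, \<open>Bt\<close>, \<open>Bs\<close> stand for the values at one point of the derivatives
  of \<open>w\<close> and \<open>B\<close> in the radial and in the angular variable. The left-hand side is the radial derivative
  of \<open>adapted_inner B w w\<close>; for constant \<open>B\<close> and \<open>wt + B ws = 0\<close> it equals the first term on the right.
\<close>
lemma growth_density_le:
  fixes B Bt :: "'b::real_inner \<Rightarrow>\<^sub>L 'b" and w wt ws :: 'b
  assumes BB: "\<And>x. B (B x) = - x"
    and nB: "norm B \<le> C" and nBt: "norm Bt \<le> \<epsilon>"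
    and g: "norm (wt + B ws) \<le> \<epsilon> * norm w"
  shows "2 * inner w wt + 2 * inner (B w) (Bt w + B wt)
           \<le> - 2 * (inner (B ws) w - inner ws (B w)) + 2 * (2 + C) * \<epsilon> * adapted_inner B w w"
proof -
  define G where "G = wt + B ws"
  define m where "m = sqrt (adapted_inner B w w)"
  have C0: "0 \<le> C" using nB norm_ge_zero order_trans by blast
  have e0: "0 \<le> \<epsilon>" using nBt norm_ge_zero order_trans by blast
  have m: "norm w \<le> m" "norm (B w) \<le> m" "0 \<le> m" "m * m = adapted_inner B w w"
    unfolding m_def using norm_le_sqrt_adapted_inner adapted_inner_nonneg[of B w] by auto
  have wt: "wt = G - B ws" by (simp add: G_def)
  have nG: "norm G \<le> \<epsilon> * m"
    using g mult_left_mono[OF m(1) e0] by (simp add: G_def)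
  have nBG: "norm (B G) \<le> C * (\<epsilon> * m)"
    by (rule order_trans[OF norm_blinfun]) (intro mult_mono nB nG C0 norm_ge_zero)
  have nBtw: "norm (Bt w) \<le> \<epsilon> * m"
    by (rule order_trans[OF norm_blinfun]) (intro mult_mono nBt m e0 norm_ge_zero)
  have i1: "inner w G \<le> m * (\<epsilon> * m)"
    by (rule order_trans[OF norm_cauchy_schwarz]) (intro mult_mono nG m norm_ge_zero)
  have i2: "inner (B w) (B G) \<le> m * (C * (\<epsilon> * m))"
    by (rule order_trans[OF norm_cauchy_schwarz]) (intro mult_mono nBG m norm_ge_zero)
  have i3: "inner (B w) (Bt w) \<le> m * (\<epsilon> * m)"
    by (rule order_trans[OF norm_cauchy_schwarz]) (intro mult_mono nBtw m norm_ge_zero)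
  have "2 * inner w wt + 2 * inner (B w) (Bt w + B wt) =
      - 2 * (inner (B ws) w - inner ws (B w)) +
      2 * (inner w G + inner (B w) (B G) + inner (B w) (Bt w))"
    by (simp add: wt blinfun.diff_right BB inner_diff_right inner_add_right inner_commute
        algebra_simps)
  also have "2 * (inner w G + inner (B w) (B G) + inner (B w) (Bt w))
      \<le> 2 * (m * (\<epsilon> * m) + m * (C * (\<epsilon> * m)) + m * (\<epsilon> * m))"
    by (intro mult_left_mono add_mono i1 i2 i3) simp
  also have "\<dots> = 2 * (2 + C) * \<epsilon> * adapted_inner B w w"
    by (simp add: m(4)[symmetric] algebra_simps)
  finally show ?thesis by simp
qed

text \<open>
  The pointwise form of the monotonicity of the frequency. The first two lines are the density of \<open>D'\<close>
  after integration by parts, the bracket multiplied by \<open>- N\<close> is the density of \<open>H'\<close>, and the two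
  terms in the fourth line integrate to \<open>2 N D - 2 N\<^sup>2 H\<close>, which is \<open>0\<close> when \<open>N = D / H\<close>; they are added
  in order to complete a square. With \<open>Y = B ws - N w\<close> and \<open>G = wt + B ws\<close>, everything of order zero in
  \<open>\<epsilon>\<close> collapses to \<open>-2 adapted_inner B Y Y\<close>. The remaining terms contain
  \<open>G\<close>, \<open>Bt\<close> or \<open>Bs\<close> and hence a factor \<open>\<epsilon>\<close>; the negative square absorbs those containing \<open>Y\<close>.
\<close>
lemma frequency_density_le:
  fixes B Bt Bs :: "'b::real_inner \<Rightarrow>\<^sub>L 'b" and w wt ws :: 'b and N :: real
  assumes BB: "\<And>x. B (B x) = - x"
    and nB: "norm B \<le> C" and nBt: "norm Bt \<le> \<epsilon>" and nBs: "norm Bs \<le> \<epsilon>"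
    and g: "norm (wt + B ws) \<le> \<epsilon> * norm w"
  shows "2 * (inner (B ws) wt - inner ws (B wt))
           + (inner (Bt ws) w - inner ws (Bt w) - inner (Bs wt) w + inner wt (Bs w))
           - N * (2 * inner w wt + 2 * inner (B w) (Bt w + B wt))
           + 2 * N * (inner (B ws) w - inner ws (B w)) - 2 * N\<^sup>2 * adapted_inner B w w
         \<le> (6 + (2 + (3 + C)\<^sup>2 / 2) * \<epsilon>) * \<epsilon> * (1 + \<bar>N\<bar>) * adapted_inner B w w"
proof -
  define G where "G = wt + B ws"
  define Y where "Y = B ws - N *\<^sub>R w"
  define m where "m = sqrt (adapted_inner B w w)"
  define y where "y = sqrt (adapted_inner B Y Y)"
  define n where "n = \<bar>N\<bar>"
  have C0: "0 \<le> C" using nB norm_ge_zero order_trans by blast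
  have e0: "0 \<le> \<epsilon>" using nBt norm_ge_zero order_trans by blast
  have n0: "0 \<le> n" by (simp add: n_def)
  have m: "norm w \<le> m" "norm (B w) \<le> m" "0 \<le> m" "m * m = adapted_inner B w w"
    unfolding m_def using norm_le_sqrt_adapted_inner adapted_inner_nonneg[of B w] by auto
  have y: "norm Y \<le> y" "norm (B Y) \<le> y" "0 \<le> y" "y * y = adapted_inner B Y Y"
    unfolding y_def using norm_le_sqrt_adapted_inner adapted_inner_nonneg[of B Y] by auto
  have Bws: "B ws = Y + N *\<^sub>R w" by (simp add: Y_def)
  have ws: "ws = - (B Y + N *\<^sub>R B w)"
    using BB[of ws] by (simp add: Bws blinfun.add_right blinfun.scaleR_right)
  have wt: "wt = G - Y - N *\<^sub>R w" by (simp add: G_def Y_def)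
  have nG: "norm G \<le> \<epsilon> * m"
    using g mult_left_mono[OF m(1) e0] by (simp add: G_def)
  have nBG: "norm (B G) \<le> C * (\<epsilon> * m)"
    by (rule order_trans[OF norm_blinfun]) (intro mult_mono nB nG C0 norm_ge_zero)
  have nBtw: "norm (Bt w) \<le> \<epsilon> * m"
    by (rule order_trans[OF norm_blinfun]) (intro mult_mono nBt m e0 norm_ge_zero)
  have nBsw: "norm (Bs w) \<le> \<epsilon> * m"
    by (rule order_trans[OF norm_blinfun]) (intro mult_mono nBs m e0 norm_ge_zero)
  have nws: "norm ws \<le> y + n * m"
  proof -
    have "norm ws \<le> norm (B Y) + norm (N *\<^sub>R B w)" unfolding ws norm_minus_cancel by (rule norm_triangle_ineq)
    also have "\<dots> \<le> y + n * m" using y(2) mult_left_mono[OF m(2) n0] by (simp add: n_def)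
    finally show ?thesis .
  qed
  have nwt: "norm wt \<le> \<epsilon> * m + y + n * m"
  proof -
    have "norm wt \<le> norm G + norm Y + norm (N *\<^sub>R w)" unfolding wt
      by (smt (verit) norm_triangle_ineq4)
    also have "\<dots> \<le> \<epsilon> * m + y + n * m" using nG y(1) mult_left_mono[OF m(1) n0] by (simp add: n_def)
    finally show ?thesis .
  qed
  have nBtws: "norm (Bt ws) \<le> \<epsilon> * (y + n * m)"
    by (rule order_trans[OF norm_blinfun]) (intro mult_mono nBt nws e0 norm_ge_zero)
  have nBswt: "norm (Bs wt) \<le> \<epsilon> * (\<epsilon> * m + y + n * m)"
    by (rule order_trans[OF norm_blinfun]) (intro mult_mono nBs nwt e0 norm_ge_zero)
  have CS: "\<bar>inner a b\<bar> \<le> p * q" if "norm a \<le> p" "norm b \<le> q" for a b :: 'b and p q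
    by (rule order_trans[OF Cauchy_Schwarz_ineq2])
      (intro mult_mono that norm_ge_zero order_trans[OF norm_ge_zero that(1)])
  have i: "\<bar>inner Y G\<bar> \<le> y * (\<epsilon> * m)" "\<bar>inner (B Y) (B G)\<bar> \<le> y * (C * (\<epsilon> * m))"
    "\<bar>inner (Bt ws) w\<bar> \<le> \<epsilon> * (y + n * m) * m" "\<bar>inner ws (Bt w)\<bar> \<le> (y + n * m) * (\<epsilon> * m)"
    "\<bar>inner (Bs wt) w\<bar> \<le> \<epsilon> * (\<epsilon> * m + y + n * m) * m"
    "\<bar>inner wt (Bs w)\<bar> \<le> (\<epsilon> * m + y + n * m) * (\<epsilon> * m)"
    by (intro CS y nG nBG nBtws m nws nBtw nBswt nwt nBsw)+
  have "\<bar>inner (B w) (Bt w)\<bar> \<le> m * (\<epsilon> * m)" by (intro CS m nBtw)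
  then have "\<bar>N * inner (B w) (Bt w)\<bar> \<le> n * (m * (\<epsilon> * m))"
    using n0 by (simp add: abs_mult n_def mult_left_mono)
  note i = i this
  \<comment> \<open>\<open>E\<close> collects what is left when \<open>Bt\<close> and \<open>Bs\<close> vanish\<close>
  define E where "E = 2 * (inner (B ws) wt - inner ws (B wt))
           - N * (2 * inner w wt + 2 * inner (B w) (B wt))
           + 2 * N * (inner (B ws) w - inner ws (B w)) - 2 * N\<^sup>2 * adapted_inner B w w"
  have E: "E = - 2 * adapted_inner B Y Y + 2 * (inner Y G + inner (B Y) (B G))"
  proof -
    have Bwt: "B wt = B G - B Y - N *\<^sub>R B w"
      by (simp add: wt blinfun.diff_right blinfun.scaleR_right)
    have "E = 2 * (inner (Y + N *\<^sub>R w) (G - Y - N *\<^sub>R w) - inner (- (B Y + N *\<^sub>R B w)) (B G - B Y - N *\<^sub>R B w))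
           - N * (2 * inner w (G - Y - N *\<^sub>R w) + 2 * inner (B w) (B G - B Y - N *\<^sub>R B w))
           + 2 * N * (inner (Y + N *\<^sub>R w) w - inner (- (B Y + N *\<^sub>R B w)) (B w)) - 2 * N\<^sup>2 * adapted_inner B w w"
      by (simp only: E_def Bwt Bws ws[symmetric] wt[symmetric])
    also have "\<dots> = - 2 * adapted_inner B Y Y + 2 * (inner Y G + inner (B Y) (B G))"
      by (simp add: adapted_inner_def inner_commute[of w Y] inner_commute[of "B w" "B Y"] inner_simps power2_eq_square algebra_simps)
    finally show ?thesis .
  qed
  \<comment> \<open>triangle inequality for the seven error terms bounded above; \<open>h\<close> will be the negative square\<close>
  have bounds: "h + 2 * (a1 + a2) + (a3 - a4 - a5 + a6) - 2 * a7
      \<le> h + 2 * b1 + 2 * b2 + b3 + b4 + b5 + b6 + 2 * b7"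
    if "\<bar>a1\<bar> \<le> b1" "\<bar>a2\<bar> \<le> b2" "\<bar>a3\<bar> \<le> b3" "\<bar>a4\<bar> \<le> b4" "\<bar>a5\<bar> \<le> b5" "\<bar>a6\<bar> \<le> b6"
      "\<bar>a7\<bar> \<le> b7" for h a1 a2 a3 a4 a5 a6 a7 b1 b2 b3 b4 b5 b6 b7 :: real
    using that[THEN abs_le_D1] that[THEN abs_le_D2] by simp
  have "2 * (inner (B ws) wt - inner ws (B wt))
           + (inner (Bt ws) w - inner ws (Bt w) - inner (Bs wt) w + inner wt (Bs w))
           - N * (2 * inner w wt + 2 * inner (B w) (Bt w + B wt))
           + 2 * N * (inner (B ws) w - inner ws (B w)) - 2 * N\<^sup>2 * adapted_inner B w w
     = E + (inner (Bt ws) w - inner ws (Bt w) - inner (Bs wt) w + inner wt (Bs w)) - 2 * (N * inner (B w) (Bt w))"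
    by (simp add: E_def inner_add_right algebra_simps)
  also have "\<dots> \<le> - 2 * (y * y) + 2 * (y * (\<epsilon> * m)) + 2 * (y * (C * (\<epsilon> * m)))
      + \<epsilon> * (y + n * m) * m + (y + n * m) * (\<epsilon> * m) + \<epsilon> * (\<epsilon> * m + y + n * m) * m
      + (\<epsilon> * m + y + n * m) * (\<epsilon> * m) + 2 * (n * (m * (\<epsilon> * m)))"
    unfolding E y(4) by (rule bounds[OF i])
  also have "\<dots> = - 2 * (y - (3 + C) / 2 * (\<epsilon> * m))\<^sup>2 + (3 + C)\<^sup>2 / 2 * (\<epsilon> * m)\<^sup>2
      + 6 * n * \<epsilon> * (m * m) + 2 * \<epsilon> * \<epsilon> * (m * m)"
  proof -
    \<comment> \<open>the mixed terms add up to \<open>4 r x y\<close>, and completing the square turns them into \<open>2 r\<^sup>2 x\<^sup>2\<close>\<close>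
    define r where "r = (3 + C) / 2"
    define x where "x = \<epsilon> * m"
    have C: "C = 2 * r - 3" by (simp add: r_def add_divide_distrib)
    have r2: "(3 + C)\<^sup>2 / 2 = 2 * (r * r)" by (simp add: r_def power2_eq_square)
    have "- 2 * (y * y) + 2 * (y * (\<epsilon> * m)) + 2 * (y * (C * (\<epsilon> * m)))
        + \<epsilon> * (y + n * m) * m + (y + n * m) * (\<epsilon> * m) + \<epsilon> * (\<epsilon> * m + y + n * m) * m
        + (\<epsilon> * m + y + n * m) * (\<epsilon> * m) + 2 * (n * (m * (\<epsilon> * m)))
      = - 2 * (y * y) + 4 * (r * (y * x)) + 6 * (n * (m * x)) + 2 * (x * x)"
      by (simp add: C x_def algebra_simps)
    also have "- 2 * (y * y) + 4 * (r * (y * x)) = - 2 * (y - r * x)\<^sup>2 + 2 * (r * r) * x\<^sup>2"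
      by (simp add: power2_eq_square algebra_simps)
    finally show ?thesis unfolding r2 by (simp add: r_def x_def algebra_simps)
  qed
  also have "\<dots> \<le> (3 + C)\<^sup>2 / 2 * (\<epsilon> * m)\<^sup>2 + 6 * n * \<epsilon> * (m * m) + 2 * \<epsilon> * \<epsilon> * (m * m)"
    by simp
  also have "\<dots> \<le> (6 + (2 + (3 + C)\<^sup>2 / 2) * \<epsilon>) * \<epsilon> * (1 + n) * (m * m)"
  proof -
    define q where "q = (3 + C)\<^sup>2 / 2"
    have q0: "0 \<le> q" by (simp add: q_def)
    have "(6 + (2 + q) * \<epsilon>) * \<epsilon> * (1 + n) * (m * m)
        - (q * (\<epsilon> * m)\<^sup>2 + 6 * n * \<epsilon> * (m * m) + 2 * \<epsilon> * \<epsilon> * (m * m))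
        = 6 * \<epsilon> * (m * m) + (2 + q) * \<epsilon> * \<epsilon> * n * (m * m)"
      by (simp add: power2_eq_square algebra_simps)
    also have "\<dots> \<ge> 0" using q0 e0 n0 m(3) by (intro add_nonneg_nonneg mult_nonneg_nonneg) auto
    finally show ?thesis by (simp add: q_def)
  qed
  finally show ?thesis by (simp add: n_def m(4))
qed

section \<open>The frequency function in logarithmic polar coordinates\<close>

text \<open>
  The differential inequality on a punctured disc, written in logarithmic polar coordinates: \<open>t\<close> is the
  logarithm of the radius and \<open>s\<close> the angle. The derivatives of \<open>B\<close> carry a factor \<open>e\<^sup>t\<close> because they
  come from a coefficient that is \<open>C\<^sup>1\<close> up to the centre of the disc, and the right-hand side of the
  equation carries it from the change of variables. \<open>Wst\<close> is the radial derivative of the angular one.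
\<close>
locale polar_system =
  fixes W Wt Ws Wst :: "real \<Rightarrow> real \<Rightarrow> 'b::euclidean_space"
    and B Bt Bs :: "real \<Rightarrow> real \<Rightarrow> 'b \<Rightarrow>\<^sub>L 'b"
    and T C :: real
  assumes W_t: "\<And>t s. t < T \<Longrightarrow> ((\<lambda>t. W t s) has_vector_derivative Wt t s) (at t)"
    and W_s: "\<And>t s. t < T \<Longrightarrow> (W t has_vector_derivative Ws t s) (at s)"
    and Ws_t: "\<And>t s. t < T \<Longrightarrow> ((\<lambda>t. Ws t s) has_vector_derivative Wst t s) (at t)"
    and B_t: "\<And>t s. t < T \<Longrightarrow> ((\<lambda>t. B t s) has_vector_derivative Bt t s) (at t)"
    and B_s: "\<And>t s. t < T \<Longrightarrow> (B t has_vector_derivative Bs t s) (at s)"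
    and cont_W: "continuous_on ({..<T} \<times> UNIV) (\<lambda>(t, s). W t s)"
    and cont_Wt: "continuous_on ({..<T} \<times> UNIV) (\<lambda>(t, s). Wt t s)"
    and cont_Ws: "continuous_on ({..<T} \<times> UNIV) (\<lambda>(t, s). Ws t s)"
    and cont_Wst: "continuous_on ({..<T} \<times> UNIV) (\<lambda>(t, s). Wst t s)"
    and cont_B: "continuous_on ({..<T} \<times> UNIV) (\<lambda>(t, s). B t s)"
    and cont_Bt: "continuous_on ({..<T} \<times> UNIV) (\<lambda>(t, s). Bt t s)"
    and cont_Bs: "continuous_on ({..<T} \<times> UNIV) (\<lambda>(t, s). Bs t s)"
    and W_periodic: "\<And>t. t < T \<Longrightarrow> W t (2 * pi) = W t 0"
    and Wt_periodic: "\<And>t. t < T \<Longrightarrow> Wt t (2 * pi) = Wt t 0"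
    and B_periodic: "\<And>t. t < T \<Longrightarrow> B t (2 * pi) = B t 0"
    and B_B: "\<And>t s x. t < T \<Longrightarrow> B t s (B t s x) = - x"
    and norm_B: "\<And>t s. t < T \<Longrightarrow> norm (B t s) \<le> C"
    and norm_Bt: "\<And>t s. t < T \<Longrightarrow> norm (Bt t s) \<le> C * exp t"
    and norm_Bs: "\<And>t s. t < T \<Longrightarrow> norm (Bs t s) \<le> C * exp t"
    and equation: "\<And>t s. t < T \<Longrightarrow> norm (Wt t s + B t s (Ws t s)) \<le> C * exp t * norm (W t s)"
begin

text \<open>
  Symmetry of the mixed second derivatives: differentiate \<open>W t r - W t 0 = \<integral>\<^sub>0\<^sup>r Ws t\<close> in \<open>t\<close> under the
  integral sign, and then apply the fundamental theorem of calculus in \<open>r\<close>.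
\<close>
lemma Wt_s:
  assumes t: "t < T" and s: "s \<in> {0..2*pi}"
  shows "(Wt t has_vector_derivative Wst t s) (at s within {0..2*pi})"
proof -
  have int_Ws: "integral {0..r} (Ws t') = W t' r - W t' 0" if "t' < T" "0 \<le> r" for t' r
    by (rule integral_unique, rule fundamental_theorem_of_calculus[OF that(2)],
        rule has_vector_derivative_at_within, rule W_s[OF that(1)])
  have slice: "continuous_on S (Wst t)" for S
  proof -
    have "continuous_on S (\<lambda>s. case (t, s) of (t, s) \<Rightarrow> Wst t s)"
      by (rule continuous_on_compose2[OF cont_Wst]) (use t in \<open>auto intro!: continuous_on_Pair\<close>)
    then show ?thesis by simp
  qed
  have slice': "continuous_on S (Ws t')" if "t' < T" for S t'
  proof -
    have "continuous_on S (\<lambda>s. case (t', s) of (t, s) \<Rightarrow> Ws t s)"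
      by (rule continuous_on_compose2[OF cont_Ws]) (use that in \<open>auto intro!: continuous_on_Pair\<close>)
    then show ?thesis by simp
  qed
  have Wt_eq: "Wt t r = Wt t 0 + integral {0..r} (Wst t)" if r: "r \<in> {0..2*pi}" for r
  proof -
    have "((\<lambda>t. integral (cbox 0 r) (Ws t)) has_vector_derivative integral (cbox 0 r) (Wst t))
            (at t within {..<T})"
    proof (rule leibniz_rule_vector_derivative)
      show "((\<lambda>t. Ws t s) has_vector_derivative Wst t' s) (at t' within {..<T})"
        if "t' \<in> {..<T}" for t' s
        using that by (auto intro: has_vector_derivative_at_within[OF Ws_t])
      show "Ws t' integrable_on cbox 0 r" if "t' \<in> {..<T}" for t'
        using that by (intro integrable_continuous slice') auto
      show "continuous_on ({..<T} \<times> cbox 0 r) (\<lambda>(t, s). Wst t s)"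
        by (rule continuous_on_subset[OF cont_Wst]) auto
    qed (use t in auto)
    then have "((\<lambda>t. integral {0..r} (Ws t)) has_vector_derivative integral {0..r} (Wst t)) (at t)"
      using t by (simp add: at_within_open[of t "{..<T}"])
    then have "((\<lambda>t. W t r - W t 0) has_vector_derivative integral {0..r} (Wst t)) (at t)"
      by (rule has_vector_derivative_transform_within_open[of _ _ _ "{..<T}"])
        (use t r int_Ws in auto)
    moreover have "((\<lambda>t. W t r - W t 0) has_vector_derivative Wt t r - Wt t 0) (at t)"
      by (intro has_vector_derivative_diff W_t t)
    ultimately have "integral {0..r} (Wst t) = Wt t r - Wt t 0"
      by (rule vector_derivative_unique_at)
    then show ?thesis by simp
  qed
  have "((\<lambda>r. Wt t 0 + integral {0..r} (Wst t)) has_vector_derivative 0 + Wst t s)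
          (at s within {0..2*pi})"
    by (intro has_vector_derivative_add has_vector_derivative_const
        integral_has_vector_derivative slice s)
  then show ?thesis
    using has_vector_derivative_transform[OF s Wt_eq] by simp
qed

text \<open>
  \<open>D t\<close> is the quadratic form of \<open>B \<partial>\<^sub>s\<close> for the inner product \<open>adapted_inner\<close>; the second term in it is
  \<open>inner (B (B Ws)) (B W)\<close> simplified by \<open>B\<^sup>2 = -1\<close>.
\<close>
definition "H t = integral {0..2*pi} (\<lambda>s. adapted_inner (B t s) (W t s) (W t s))"
definition "D t = integral {0..2*pi}
  (\<lambda>s. inner (B t s (Ws t s)) (W t s) - inner (Ws t s) (B t s (W t s)))"

text \<open>
  The density for \<open>D\<close> is not the \<open>t\<close>-derivative of the integrand of \<open>D\<close>: it differs from it by a total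
  angular derivative, chosen so that no second derivative of \<open>W\<close> remains.
\<close>
definition "H_density' t s =
  2 * inner (W t s) (Wt t s) + 2 * inner (B t s (W t s)) (Bt t s (W t s) + B t s (Wt t s))"
definition "D_density' t s =
  2 * (inner (B t s (Ws t s)) (Wt t s) - inner (Ws t s) (B t s (Wt t s)))
  + (inner (Bt t s (Ws t s)) (W t s) - inner (Ws t s) (Bt t s (W t s))
     - inner (Bs t s (Wt t s)) (W t s) + inner (Wt t s) (Bs t s (W t s)))"

definition "H' t = integral {0..2*pi} (H_density' t)"
definition "D' t = integral {0..2*pi} (D_density' t)"

lemma continuous_components:
  "continuous_on ({..<T} \<times> S) (\<lambda>x. W (fst x) (snd x))"
  "continuous_on ({..<T} \<times> S) (\<lambda>x. Wt (fst x) (snd x))"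
  "continuous_on ({..<T} \<times> S) (\<lambda>x. Ws (fst x) (snd x))"
  "continuous_on ({..<T} \<times> S) (\<lambda>x. Wst (fst x) (snd x))"
  "continuous_on ({..<T} \<times> S) (\<lambda>x. B (fst x) (snd x))"
  "continuous_on ({..<T} \<times> S) (\<lambda>x. Bt (fst x) (snd x))"
  "continuous_on ({..<T} \<times> S) (\<lambda>x. Bs (fst x) (snd x))"
  using cont_W cont_Wt cont_Ws cont_Wst cont_B cont_Bt cont_Bs
  by (auto simp: case_prod_beta intro: continuous_on_subset[of "{..<T} \<times> UNIV"])

lemmas continuous_rules = continuous_intros continuous_components
  bounded_bilinear.continuous_on[OF bounded_bilinear_blinfun_apply]

lemma continuous_slice:
  assumes "continuous_on ({..<T} \<times> UNIV) (\<lambda>x. f (fst x) (snd x))" and "t < T"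
  shows "continuous_on S (f t)"
proof -
  have "continuous_on S (\<lambda>s. f (fst (t, s)) (snd (t, s)))"
    by (rule continuous_on_compose2[OF assms(1)]) (use assms(2) in \<open>auto intro!: continuous_on_Pair\<close>)
  then show ?thesis by simp
qed

lemma continuous_H_density:
  "continuous_on ({..<T} \<times> S) (\<lambda>x. adapted_inner (B (fst x) (snd x)) (W (fst x) (snd x)) (W (fst x) (snd x)))"
  unfolding adapted_inner_def by (intro continuous_rules)

lemma continuous_D_density:
  "continuous_on ({..<T} \<times> S) (\<lambda>x. inner (B (fst x) (snd x) (Ws (fst x) (snd x))) (W (fst x) (snd x))
     - inner (Ws (fst x) (snd x)) (B (fst x) (snd x) (W (fst x) (snd x))))"
  by (intro continuous_rules)

lemma continuous_H_density':
  "continuous_on ({..<T} \<times> S) (\<lambda>x. H_density' (fst x) (snd x))"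
  unfolding H_density'_def by (intro continuous_rules)

lemma continuous_D_density':
  "continuous_on ({..<T} \<times> S) (\<lambda>x. D_density' (fst x) (snd x))"
  unfolding D_density'_def by (intro continuous_rules)

lemma has_integral_densities:
  assumes "t < T"
  shows "((\<lambda>s. adapted_inner (B t s) (W t s) (W t s)) has_integral H t) {0..2*pi}"
    and "((\<lambda>s. inner (B t s (Ws t s)) (W t s) - inner (Ws t s) (B t s (W t s))) has_integral D t) {0..2*pi}"
    and "(H_density' t has_integral H' t) {0..2*pi}"
    and "(D_density' t has_integral D' t) {0..2*pi}"
  unfolding H_def D_def H'_def D'_def
  by (intro integrable_integral integrable_continuous_real
      continuous_slice[OF continuous_H_density assms]
      continuous_slice[OF continuous_D_density assms]
      continuous_slice[OF continuous_H_density' assms]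
      continuous_slice[OF continuous_D_density' assms])+

lemma has_real_derivative_circle_integral:
  fixes f :: "real \<Rightarrow> real \<Rightarrow> real"
  assumes "\<And>t s. t < T \<Longrightarrow> ((\<lambda>t. f t s) has_vector_derivative f' t s) (at t)"
    and "continuous_on ({..<T} \<times> UNIV) (\<lambda>x. f (fst x) (snd x))"
    and "continuous_on ({..<T} \<times> UNIV) (\<lambda>x. f' (fst x) (snd x))"
    and t: "t < T"
  shows "((\<lambda>t. integral {0..2*pi} (f t)) has_real_derivative integral {0..2*pi} (f' t)) (at t)"
proof -
  have "((\<lambda>t. integral (cbox 0 (2*pi)) (f t)) has_vector_derivative
          integral (cbox 0 (2*pi)) (f' t)) (at t within {..<T})"
  proof (rule leibniz_rule_vector_derivative)
    show "((\<lambda>t. f t s) has_vector_derivative f' t' s) (at t' within {..<T})"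
      if "t' \<in> {..<T}" for t' s
      using that by (auto intro: has_vector_derivative_at_within[OF assms(1)])
    show "f t' integrable_on cbox 0 (2*pi)" if "t' \<in> {..<T}" for t'
      using that by (intro integrable_continuous continuous_slice[OF assms(2)]) auto
    show "continuous_on ({..<T} \<times> cbox 0 (2*pi)) (\<lambda>(t, s). f' t s)"
      using assms(3) by (auto simp: case_prod_beta intro: continuous_on_subset)
  qed (use t in auto)
  then show ?thesis
    using t by (simp add: at_within_open[of t "{..<T}"] has_real_derivative_iff_has_vector_derivative)
qed

lemmas product_rules =
  bounded_bilinear.has_vector_derivative[OF bounded_bilinear_inner]
  bounded_bilinear.has_vector_derivative[OF bounded_bilinear_blinfun_apply]

lemma H_deriv:
  assumes "t < T"
  shows "(H has_real_derivative H' t) (at t)"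
  unfolding H_def H'_def
proof (rule has_real_derivative_circle_integral[OF _ continuous_H_density continuous_H_density' assms])
  fix t s assume "t < T"
  note d = W_t[OF this, of s] B_t[OF this, of s]
  show "((\<lambda>t. adapted_inner (B t s) (W t s) (W t s)) has_vector_derivative H_density' t s) (at t)"
    unfolding adapted_inner_def
    by (rule has_vector_derivative_eq_rhs, rule has_vector_derivative_add, (rule product_rules d)+)
      (simp add: H_density'_def inner_commute algebra_simps)
qed

text \<open>
  Differentiation under the integral gives the density \<open>e\<close>, which contains \<open>Wst\<close>. Subtracting the angular
  derivative of the periodic function \<open>q\<close>, whose integral vanishes, removes \<open>Wst\<close>. What this costs
  are the terms with \<open>Bs\<close>, of size \<open>e\<^sup>t\<close>: they express that \<open>B \<partial>\<^sub>s\<close> is symmetric only up to an error.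
\<close>
lemma D_deriv:
  assumes t: "t < T"
  shows "(D has_real_derivative D' t) (at t)"
proof -
  define e where "e t s = inner (Bt t s (Ws t s) + B t s (Wst t s)) (W t s) + inner (B t s (Ws t s)) (Wt t s)
    - (inner (Wst t s) (B t s (W t s)) + inner (Ws t s) (Bt t s (W t s) + B t s (Wt t s)))" for t s
  define q where "q s = inner (B t s (Wt t s)) (W t s) - inner (Wt t s) (B t s (W t s))" for s
  define q' where "q' s = inner (Bs t s (Wt t s) + B t s (Wst t s)) (W t s) + inner (B t s (Wt t s)) (Ws t s)
    - (inner (Wst t s) (B t s (W t s)) + inner (Wt t s) (Bs t s (W t s) + B t s (Ws t s)))" for s
  have cont_e: "continuous_on ({..<T} \<times> S) (\<lambda>x. e (fst x) (snd x))" for S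
    unfolding e_def by (intro continuous_rules)
  have "(D has_real_derivative integral {0..2*pi} (e t)) (at t)"
    unfolding D_def
  proof (rule has_real_derivative_circle_integral[OF _ continuous_D_density cont_e assms])
    fix t s assume "t < T"
    note d = W_t[OF this, of s] B_t[OF this, of s] Ws_t[OF this, of s]
    show "((\<lambda>t. inner (B t s (Ws t s)) (W t s) - inner (Ws t s) (B t s (W t s)))
            has_vector_derivative e t s) (at t)"
      by (rule has_vector_derivative_eq_rhs, rule has_vector_derivative_diff, (rule product_rules d)+)
        (simp add: e_def algebra_simps)
  qed
  moreover have "integral {0..2*pi} (e t) = D' t"
  proof -
    have "(q' has_integral q (2*pi) - q 0) {0..2*pi}"
    proof (rule fundamental_theorem_of_calculus)
      fix s assume s: "s \<in> {0..2*pi}"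
      note d = W_s[OF t, of s, THEN has_vector_derivative_at_within]
        B_s[OF t, of s, THEN has_vector_derivative_at_within] Wt_s[OF t s]
      show "(q has_vector_derivative q' s) (at s within {0..2*pi})"
        unfolding q_def
        by (rule has_vector_derivative_eq_rhs, rule has_vector_derivative_diff, (rule product_rules d)+)
          (simp add: q'_def algebra_simps)
    qed simp
    then have q': "(q' has_integral 0) {0..2*pi}"
      using W_periodic Wt_periodic B_periodic t by (simp add: q_def)
    have "(e t has_integral integral {0..2*pi} (e t)) {0..2*pi}"
      by (intro integrable_integral integrable_continuous_real continuous_slice[OF cont_e t])
    from has_integral_diff[OF this q']
    have "((\<lambda>s. e t s - q' s) has_integral integral {0..2*pi} (e t)) {0..2*pi}" by simp
    moreover have "(\<lambda>s. e t s - q' s) = D_density' t"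
      by (auto simp: e_def q'_def D_density'_def inner_simps inner_commute algebra_simps)
    ultimately show ?thesis using has_integral_densities(4)[OF t] has_integral_unique by metis
  qed
  ultimately show ?thesis by simp
qed

lemma H_nonneg: "t < T \<Longrightarrow> 0 \<le> H t"
  using has_integral_nonneg[OF has_integral_densities(1)] adapted_inner_nonneg by blast

lemma H'_le: 
  assumes t: "t < T"
  shows "H' t \<le> - 2 * D t + 2 * (2 + C) * (C * exp t) * H t"
proof (rule has_integral_le[OF has_integral_densities(3)[OF t]])
  note I = has_integral_densities[OF t]
  show "((\<lambda>s. - 2 * (inner (B t s (Ws t s)) (W t s) - inner (Ws t s) (B t s (W t s)))
      + 2 * (2 + C) * (C * exp t) * adapted_inner (B t s) (W t s) (W t s))
    has_integral - 2 * D t + 2 * (2 + C) * (C * exp t) * H t) {0..2*pi}"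
    by (intro has_integral_add has_integral_mult_right I)
next
  fix s
  show "H_density' t s \<le> - 2 * (inner (B t s (Ws t s)) (W t s) - inner (Ws t s) (B t s (W t s)))
      + 2 * (2 + C) * (C * exp t) * adapted_inner (B t s) (W t s) (W t s)"
    unfolding H_density'_def
    by (rule growth_density_le[OF B_B norm_B norm_Bt equation]) (rule t)+
qed

lemma D'_le:
  assumes t: "t < T" and "H t > 0"
  shows "D' t - D t / H t * H' t
    \<le> (6 + (2 + (3 + C)\<^sup>2 / 2) * (C * exp t)) * (C * exp t) * (1 + \<bar>D t / H t\<bar>) * H t"
proof -
  define N where "N = D t / H t"
  note I = has_integral_densities[OF t]
  have "((\<lambda>s. D_density' t s - N * H_density' t s
      + 2 * N * (inner (B t s (Ws t s)) (W t s) - inner (Ws t s) (B t s (W t s)))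
      - 2 * N\<^sup>2 * adapted_inner (B t s) (W t s) (W t s))
    has_integral D' t - N * H' t + 2 * N * D t - 2 * N\<^sup>2 * H t) {0..2*pi}"
    by (intro has_integral_add has_integral_diff has_integral_mult_right I)
  moreover have "((\<lambda>s. (6 + (2 + (3 + C)\<^sup>2 / 2) * (C * exp t)) * (C * exp t) * (1 + \<bar>N\<bar>) *
        adapted_inner (B t s) (W t s) (W t s)) has_integral
      (6 + (2 + (3 + C)\<^sup>2 / 2) * (C * exp t)) * (C * exp t) * (1 + \<bar>N\<bar>) * H t) {0..2*pi}"
    by (intro has_integral_mult_right I)
  ultimately have "D' t - N * H' t + 2 * N * D t - 2 * N\<^sup>2 * H t
    \<le> (6 + (2 + (3 + C)\<^sup>2 / 2) * (C * exp t)) * (C * exp t) * (1 + \<bar>N\<bar>) * H t"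
  proof (rule has_integral_le)
    fix s
    show "D_density' t s - N * H_density' t s
        + 2 * N * (inner (B t s (Ws t s)) (W t s) - inner (Ws t s) (B t s (W t s)))
        - 2 * N\<^sup>2 * adapted_inner (B t s) (W t s) (W t s)
      \<le> (6 + (2 + (3 + C)\<^sup>2 / 2) * (C * exp t)) * (C * exp t) * (1 + \<bar>N\<bar>) *
        adapted_inner (B t s) (W t s) (W t s)"
      unfolding D_density'_def H_density'_def
      by (rule frequency_density_le[OF B_B norm_B norm_Bt norm_Bs equation]) (rule t)+
  qed
  moreover have "2 * N * D t - 2 * N\<^sup>2 * H t = 0"
    using \<open>H t > 0\<close> by (simp add: N_def power2_eq_square)
  ultimately show ?thesis by (simp add: N_def)
qed

lemma C_nonneg: "t < T \<Longrightarrow> 0 \<le> C"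
  using norm_B norm_ge_zero order_trans by blast

lemma H_lower_bound:
  assumes "t0 < T" and "H t0 > 0"
  shows "\<exists>K. \<forall>t\<le>t0. H t0 * exp (K * (t - t0)) \<le> H t"
proof -
  define c where "c = (2 * (2 + C) + 6 + (2 + (3 + C)\<^sup>2 / 2) * (C * exp T)) * C"
  have C: "0 \<le> C" using C_nonneg assms by blast
  have c_le: "a * (C * exp t) * b \<le> c * exp t * b"
    if "a \<le> 2 * (2 + C) + 6 + (2 + (3 + C)\<^sup>2 / 2) * (C * exp T)" "0 \<le> b" for a b t
    unfolding c_def mult.assoc[symmetric] using that C by (intro mult_right_mono) auto
  \<comment> \<open>isolated so that the factor of \<open>e\<^sup>t\<close> is visibly nonnegative and \<open>t\<close> may be replaced by \<open>T\<close>\<close>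
  have q: "0 \<le> (2 + (3 + C)\<^sup>2 / 2) * C" using C by (intro mult_nonneg_nonneg) auto
  show ?thesis
  proof (rule exponential_lower_bound[OF _ H_deriv D_deriv H_nonneg _ _ assms])
    show "0 \<le> c" unfolding c_def using C by (intro mult_nonneg_nonneg add_nonneg_nonneg) auto
    fix t assume t: "t < T"
    have "2 * (2 + C) \<le> 2 * (2 + C) + 6 + (2 + (3 + C)\<^sup>2 / 2) * (C * exp T)"
      using mult_nonneg_nonneg[OF q, of "exp T"] by (simp add: mult.assoc)
    from c_le[OF this H_nonneg[OF t]] H'_le[OF t]
    show "H' t \<le> - 2 * D t + c * exp t * H t" by (meson add_left_mono order_trans)
    assume H: "H t > 0"
    have "6 + (2 + (3 + C)\<^sup>2 / 2) * (C * exp t)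
        \<le> 2 * (2 + C) + 6 + (2 + (3 + C)\<^sup>2 / 2) * (C * exp T)"
      using mult_left_mono[OF _ q, of "exp t" "exp T"] t C by (simp add: mult.assoc)
    then have "(6 + (2 + (3 + C)\<^sup>2 / 2) * (C * exp t)) * (C * exp t) * ((1 + \<bar>D t / H t\<bar>) * H t)
        \<le> c * exp t * ((1 + \<bar>D t / H t\<bar>) * H t)"
      using H by (intro c_le) auto
    then show "D' t - D t / H t * H' t \<le> c * exp t * (1 + \<bar>D t / H t\<bar>) * H t"
      using D'_le[OF t H] by (simp only: mult.assoc)
  qed
qed

lemma H_le:
  assumes t: "t < T" and W: "\<And>s. norm (W t s) \<le> M"
  shows "H t \<le> 2 * pi * ((1 + C\<^sup>2) * M\<^sup>2)"
proof (rule has_integral_le[OF has_integral_densities(1)[OF t]])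
  show "((\<lambda>s. (1 + C\<^sup>2) * M\<^sup>2) has_integral 2 * pi * ((1 + C\<^sup>2) * M\<^sup>2)) {0..2*pi}"
    using has_integral_const_real[of "(1 + C\<^sup>2) * M\<^sup>2" 0 "2 * pi"] by simp
next
  fix s
  have w: "(norm (W t s))\<^sup>2 \<le> M\<^sup>2" by (intro power_mono W norm_ge_zero)
  have "norm (B t s (W t s)) \<le> C * norm (W t s)"
    by (rule order_trans[OF norm_blinfun mult_right_mono[OF norm_B[OF t]]]) simp
  then have "(norm (B t s (W t s)))\<^sup>2 \<le> C\<^sup>2 * (norm (W t s))\<^sup>2"
    by (metis norm_ge_zero power_mono power_mult_distrib)
  also have "\<dots> \<le> C\<^sup>2 * M\<^sup>2" by (intro mult_left_mono w) simp
  finally show "adapted_inner (B t s) (W t s) (W t s) \<le> (1 + C\<^sup>2) * M\<^sup>2"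
    using w by (simp add: adapted_inner_def power2_norm_eq_inner distrib_right)
qed

lemma W_eq_0_if_H_eq_0:
  assumes t: "t < T" and "H t = 0" and s: "s \<in> {0..2*pi}"
  shows "W t s = 0"
proof -
  have "integral (cbox 0 (2*pi)) (\<lambda>s. adapted_inner (B t s) (W t s) (W t s)) = 0 \<longleftrightarrow>
      (\<forall>s\<in>cbox 0 (2*pi). adapted_inner (B t s) (W t s) (W t s) = 0)"
    using continuous_slice[OF continuous_H_density t, of "{0..2*pi}"]
    by (intro integral_cbox_eq_0_iff) (auto simp: adapted_inner_nonneg not_le)
  then have "adapted_inner (B t s) (W t s) (W t s) = 0"
    using assms by (simp add: H_def)
  then show ?thesis
    by (smt (verit) adapted_inner_def inner_ge_zero inner_eq_zero_iff)
qed

text \<open>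
  Flatness makes \<open>H\<close> smaller than every exponential \<open>e\<^sup>2\<^sup>N\<^sup>t\<close> as \<open>t \<rightarrow> -\<infinity>\<close>, whereas a single positive
  value of \<open>H\<close> forces an exponential lower bound.
\<close>
lemma flat_imp_zero:
  assumes flat: "\<And>N::nat. \<exists>M t1. \<forall>t<t1. \<forall>s. norm (W t s) \<le> M * exp t ^ N"
    and "t0 < T" and "s \<in> {0..2*pi}"
  shows "W t0 s = 0"
proof (rule W_eq_0_if_H_eq_0[OF \<open>t0 < T\<close> _ \<open>s \<in> _\<close>], rule ccontr)
  assume "H t0 \<noteq> 0"
  then have H0: "H t0 > 0" using H_nonneg[OF \<open>t0 < T\<close>] by simp
  then obtain K where K: "\<And>t. t \<le> t0 \<Longrightarrow> H t0 * exp (K * (t - t0)) \<le> H t"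
    using H_lower_bound[OF \<open>t0 < T\<close>] by blast
  obtain N :: nat where N: "K < real N" using reals_Archimedean2 by blast
  define a where "a = 2 * real N - K"
  have a: "0 < a" using N by (simp add: a_def)
  obtain M t1 where M: "\<And>t s. t < t1 \<Longrightarrow> norm (W t s) \<le> M * exp t ^ N"
    using flat by blast
  define Q where "Q = 2 * pi * ((1 + C\<^sup>2) * M\<^sup>2)"
  have bound: "H t0 * exp (- K * t0) \<le> Q * exp (a * t)" if "t \<le> t0" "t < t1" for t
  proof -
    have "H t0 * exp (K * (t - t0)) \<le> 2 * pi * ((1 + C\<^sup>2) * (M * exp t ^ N)\<^sup>2)"
      using K[of t] H_le[of t "M * exp t ^ N"] M[of t] that \<open>t0 < T\<close> by force
    also have "\<dots> = Q * exp (2 * real N * t)"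
      by (simp add: Q_def power_mult_distrib power_mult[symmetric] exp_of_nat_mult[symmetric] mult_ac)
    finally have "H t0 * exp (K * (t - t0)) * exp (- K * t) \<le> Q * exp (2 * real N * t) * exp (- K * t)"
      by (rule mult_right_mono) simp
    then show ?thesis by (simp add: a_def mult.assoc exp_add[symmetric] algebra_simps)
  qed
  have "((\<lambda>t. Q * exp (a * t)) \<longlongrightarrow> Q * 0) at_bot"
    by (intro tendsto_mult tendsto_const filterlim_compose[OF exp_at_bot]
        filterlim_tendsto_pos_mult_at_bot[OF tendsto_const a filterlim_ident])
  then have "H t0 * exp (- K * t0) \<le> Q * 0"
  proof (rule tendsto_lowerbound)
    show "\<forall>\<^sub>F t in at_bot. H t0 * exp (- K * t0) \<le> Q * exp (a * t)"
      unfolding eventually_at_bot_linorder using bound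
      by (intro exI[of _ "min t0 (t1 - 1)"]) auto
  qed simp
  then show False using H0 by (simp add: mult_le_0_iff not_le)
qed

end

section \<open>Partial derivatives in the plane and polar coordinates\<close>

definition has_partials_on ::
    "(complex \<Rightarrow> 'b::real_normed_vector) \<Rightarrow> (complex \<Rightarrow> 'b) \<Rightarrow> (complex \<Rightarrow> 'b) \<Rightarrow> complex set \<Rightarrow> bool" where
  "has_partials_on f f1 f2 X \<longleftrightarrow>
     (\<forall>x\<in>X. (f has_derivative (\<lambda>h. Re h *\<^sub>R f1 x + Im h *\<^sub>R f2 x)) (at x)) \<and>
     continuous_on X f1 \<and> continuous_on X f2"

lemma has_partials_on_imp_continuous_on: "has_partials_on f f1 f2 X \<Longrightarrow> continuous_on X f"
  by (auto simp: has_partials_on_def intro!: continuous_at_imp_continuous_on has_derivative_continuous)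

lemma has_vector_derivative_along_path:
  assumes "has_partials_on f f1 f2 X" and "\<gamma> t \<in> X" and "(\<gamma> has_vector_derivative d) (at t)"
  shows "((\<lambda>t. f (\<gamma> t)) has_vector_derivative Re d *\<^sub>R f1 (\<gamma> t) + Im d *\<^sub>R f2 (\<gamma> t)) (at t)"
proof -
  have "((\<lambda>t. f (\<gamma> t)) has_derivative
      (\<lambda>h. Re (h *\<^sub>R d) *\<^sub>R f1 (\<gamma> t) + Im (h *\<^sub>R d) *\<^sub>R f2 (\<gamma> t))) (at t)"
    by (rule has_derivative_compose[of \<gamma> "\<lambda>h. h *\<^sub>R d" t UNIV f])
      (use assms in \<open>auto simp: has_partials_on_def has_vector_derivative_def\<close>)
  then show ?thesis by (simp add: has_vector_derivative_def scaleR_add_right)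
qed

lemma partial_x1_eq: "has_partials_on f f1 f2 X \<Longrightarrow> x \<in> X \<Longrightarrow> partial_x1 f x = f1 x"
  unfolding partial_x1_def
  using has_vector_derivative_along_path[of f f1 f2 X "\<lambda>t. Complex t (Im x)" "Re x" 1]
  by (auto intro!: vector_derivative_at derivative_eq_intros
      simp: has_vector_derivative_complex_iff)

lemma partial_x2_eq: "has_partials_on f f1 f2 X \<Longrightarrow> x \<in> X \<Longrightarrow> partial_x2 f x = f2 x"
  unfolding partial_x2_def
  using has_vector_derivative_along_path[of f f1 f2 X "\<lambda>t. Complex (Re x) t" "Im x" \<i>]
  by (auto intro!: vector_derivative_at derivative_eq_intros
      simp: has_vector_derivative_complex_iff)

definition polar :: "complex \<Rightarrow> real \<Rightarrow> real \<Rightarrow> complex" where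
  "polar p t s = p + exp t *\<^sub>R cis s"

lemma dist_polar: "dist p (polar p t s) = exp t"
  by (simp add: polar_def dist_norm)

lemma polar_surj:
  assumes "x \<noteq> p"
  shows "\<exists>s\<in>{0..2*pi}. x = polar p (ln (dist p x)) s"
proof (intro bexI)
  show "x = polar p (ln (dist p x)) (Arg2pi (x - p))"
    using Arg2pi_eq[of "x - p"] assms
    by (simp add: polar_def dist_norm norm_minus_commute scaleR_conv_of_real cis_conv_exp algebra_simps)
  show "Arg2pi (x - p) \<in> {0..2*pi}"
    using Arg2pi_ge_0[of "x - p"] Arg2pi_lt_2pi[of "x - p"] by auto
qed

lemma continuous_on_polar: "continuous_on S (\<lambda>(t, s). polar p t s)"
  unfolding polar_def case_prod_beta by (intro continuous_intros)

lemma polar_t: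
  assumes "has_partials_on f f1 f2 X" and "polar p t s \<in> X"
  shows "((\<lambda>t. f (polar p t s)) has_vector_derivative
    (exp t * cos s) *\<^sub>R f1 (polar p t s) + (exp t * sin s) *\<^sub>R f2 (polar p t s)) (at t)"
proof -
  have "((\<lambda>t. polar p t s) has_vector_derivative exp t *\<^sub>R cis s) (at t)"
    unfolding polar_def has_vector_derivative_complex_iff
    by (auto intro!: derivative_eq_intros)
  from has_vector_derivative_along_path[OF assms(1) _ this] assms(2) show ?thesis by simp
qed

lemma polar_s:
  assumes "has_partials_on f f1 f2 X" and "polar p t s \<in> X"
  shows "((\<lambda>s. f (polar p t s)) has_vector_derivative
    (- (exp t * sin s)) *\<^sub>R f1 (polar p t s) + (exp t * cos s) *\<^sub>R f2 (polar p t s)) (at s)"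
proof -
  have "((\<lambda>s. polar p t s) has_vector_derivative exp t *\<^sub>R (\<i> * cis s)) (at s)"
    unfolding polar_def has_vector_derivative_complex_iff
    by (auto intro!: derivative_eq_intros)
  from has_vector_derivative_along_path[OF assms(1) _ this] assms(2) show ?thesis by simp
qed

section \<open>Strong unique continuation for a linear inequality\<close>

text \<open>
  In polar coordinates \<open>Wt + B Ws = (r cos \<theta> - r sin \<theta> A) (w1 + A w2)\<close>, by \<open>A\<^sup>2 = -1\<close>. So the differential
  inequality keeps its form, with the coefficient \<open>A\<close> itself in front of the angular derivative.
\<close>
lemma unique_continuation_disc:
  fixes w :: "complex \<Rightarrow> 'b::euclidean_space" and A :: "complex \<Rightarrow> 'b \<Rightarrow>\<^sub>L 'b"
  assumes "cball p R \<subseteq> X"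
    and w: "has_partials_on w w1 w2 X" and w1: "has_partials_on w1 w11 w12 X"
    and w2: "has_partials_on w2 w21 w22 X" and A: "has_partials_on A A1 A2 X"
    and A_A: "\<And>x y. x \<in> X \<Longrightarrow> A x (A x y) = - y"
    and L: "\<And>x. x \<in> cball p R \<Longrightarrow> norm (w1 x + A x (w2 x)) \<le> L * norm (w x)"
    and flat: "\<And>N::nat. \<exists>M. \<forall>\<^sub>F x in nhds p. norm (w x) \<le> M * dist p x ^ N"
    and x: "x \<in> ball p R"
  shows "w x = 0"
proof (cases "x = p")
  case True
  \<comment> \<open>polar coordinates miss the centre, where flatness of order one suffices\<close>
  obtain M where "\<forall>\<^sub>F x in nhds p. norm (w x) \<le> M * dist p x ^ 1" using flat by blast
  then have "norm (w p) \<le> M * dist p p ^ 1" by (rule eventually_nhds_x_imp_x)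
  then show ?thesis using True by simp
next
  case False
  have R: "0 < R" using x by (metis mem_ball zero_le_dist le_less_trans)
  define T where "T = ln R"
  have in_cball: "polar p t s \<in> cball p R" if "t < T" for t s
  proof -
    have "exp t < exp T" using that by simp
    then show ?thesis using R by (simp add: dist_polar T_def)
  qed
  then have in_X: "polar p t s \<in> X" if "t < T" for t s
    using that \<open>cball p R \<subseteq> X\<close> by blast
  have bounded: "\<exists>M\<ge>0. \<forall>x\<in>cball p R. norm (f x) \<le> M" if "continuous_on X f"
    for f :: "complex \<Rightarrow> 'b \<Rightarrow>\<^sub>L 'b"
  proof -
    have "compact (f ` cball p R)"
      using continuous_on_subset[OF that \<open>cball p R \<subseteq> X\<close>] by (intro compact_continuous_image) auto
    then obtain M where "0 < M" "\<forall>y\<in>f ` cball p R. norm y \<le> M"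
      using bounded_pos compact_imp_bounded by metis
    then show ?thesis by (intro exI[of _ M]) auto
  qed
  obtain a where a: "0 \<le> a" "\<And>x. x \<in> cball p R \<Longrightarrow> norm (A x) \<le> a"
    using bounded[OF has_partials_on_imp_continuous_on[OF A]] by blast
  obtain a1 where a1: "0 \<le> a1" "\<And>x. x \<in> cball p R \<Longrightarrow> norm (A1 x) \<le> a1"
    using bounded[of A1] A by (auto simp: has_partials_on_def)
  obtain a2 where a2: "0 \<le> a2" "\<And>x. x \<in> cball p R \<Longrightarrow> norm (A2 x) \<le> a2"
    using bounded[of A2] A by (auto simp: has_partials_on_def)
  \<comment> \<open>one constant that serves for all four bounds of the polar system\<close>
  define C where "C = a + a1 + a2 + (1 + a) * \<bar>L\<bar>"
  have C: "a \<le> C" "a1 + a2 \<le> C" "(1 + a) * \<bar>L\<bar> \<le> C"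
    using a(1) a1(1) a2(1) by (auto simp: C_def)
  define W where "W t s = w (polar p t s)" for t s
  define Wt where "Wt t s = (exp t * cos s) *\<^sub>R w1 (polar p t s) + (exp t * sin s) *\<^sub>R w2 (polar p t s)" for t s
  define Ws where "Ws t s = (- (exp t * sin s)) *\<^sub>R w1 (polar p t s) + (exp t * cos s) *\<^sub>R w2 (polar p t s)" for t s
  define Wst where "Wst t s =
      ((- (exp t * sin s)) *\<^sub>R ((exp t * cos s) *\<^sub>R w11 (polar p t s) + (exp t * sin s) *\<^sub>R w12 (polar p t s))
      + (- (exp t * sin s)) *\<^sub>R w1 (polar p t s))
      + ((exp t * cos s) *\<^sub>R ((exp t * cos s) *\<^sub>R w21 (polar p t s) + (exp t * sin s) *\<^sub>R w22 (polar p t s))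
      + (exp t * cos s) *\<^sub>R w2 (polar p t s))" for t s
  define B where "B t s = A (polar p t s)" for t s
  define Bt where "Bt t s = (exp t * cos s) *\<^sub>R A1 (polar p t s) + (exp t * sin s) *\<^sub>R A2 (polar p t s)" for t s
  define Bs where "Bs t s = (- (exp t * sin s)) *\<^sub>R A1 (polar p t s) + (exp t * cos s) *\<^sub>R A2 (polar p t s)" for t s
  have cont: "continuous_on ({..<T} \<times> UNIV) (\<lambda>x. f (polar p (fst x) (snd x)))"
    if "continuous_on X f" for f :: "complex \<Rightarrow> 'd::real_normed_vector"
    using continuous_on_polar[of "{..<T} \<times> UNIV" p]
    by (intro continuous_on_compose2[OF that]) (auto simp: case_prod_beta intro: in_X)
  note conts = has_partials_on_imp_continuous_on[OF w] has_partials_on_imp_continuous_on[OF w1]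
    has_partials_on_imp_continuous_on[OF w2] has_partials_on_imp_continuous_on[OF A]
    w1[unfolded has_partials_on_def, THEN conjunct2, THEN conjunct1]
    w1[unfolded has_partials_on_def, THEN conjunct2, THEN conjunct2]
    w2[unfolded has_partials_on_def, THEN conjunct2, THEN conjunct1]
    w2[unfolded has_partials_on_def, THEN conjunct2, THEN conjunct2]
    A[unfolded has_partials_on_def, THEN conjunct2, THEN conjunct1]
    A[unfolded has_partials_on_def, THEN conjunct2, THEN conjunct2]
  have combination_le: "norm (a *\<^sub>R P + b *\<^sub>R Q) \<le> C * r"
    if "\<bar>a\<bar> \<le> r" "\<bar>b\<bar> \<le> r" "norm P \<le> a1" "norm Q \<le> a2" for a b r and P Q :: "'b \<Rightarrow>\<^sub>L 'b"
  proof -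
    have r: "0 \<le> r" using that(1) by linarith
    have "norm (a *\<^sub>R P + b *\<^sub>R Q) \<le> \<bar>a\<bar> * norm P + \<bar>b\<bar> * norm Q"
      using norm_triangle_ineq[of "a *\<^sub>R P" "b *\<^sub>R Q"] by simp
    also have "\<dots> \<le> r * a1 + r * a2"
      using that r by (intro add_mono mult_mono) auto
    also have "\<dots> \<le> C * r"
      using mult_right_mono[OF C(2) r] by (simp add: algebra_simps)
    finally show ?thesis .
  qed
  interpret polar_system W Wt Ws Wst B Bt Bs T C
  proof
    fix t s :: real assume t: "t < T"
    note q = in_X[OF t, of s] and k = in_cball[OF t, of s]
    show "((\<lambda>t. W t s) has_vector_derivative Wt t s) (at t)"
      unfolding W_def Wt_def by (rule polar_t[OF w q])
    show "(W t has_vector_derivative Ws t s) (at s)"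
      unfolding W_def Ws_def by (rule polar_s[OF w q])
    show "((\<lambda>t. Ws t s) has_vector_derivative Wst t s) (at t)"
      unfolding Ws_def Wst_def
      by (intro has_vector_derivative_add has_vector_derivative_scaleR polar_t[OF w1 q] polar_t[OF w2 q])
        (auto intro!: derivative_eq_intros)
    show "((\<lambda>t. B t s) has_vector_derivative Bt t s) (at t)"
      unfolding B_def Bt_def by (rule polar_t[OF A q])
    show "(B t has_vector_derivative Bs t s) (at s)"
      unfolding B_def Bs_def by (rule polar_s[OF A q])
    show "B t s (B t s y) = - y" for y
      unfolding B_def by (rule A_A[OF q])
    show "norm (B t s) \<le> C"
      unfolding B_def using a(2)[OF k] C(1) by simp
    have le: "\<bar>exp t * sin s\<bar> \<le> exp t" "\<bar>- (exp t * sin s)\<bar> \<le> exp t" "\<bar>exp t * cos s\<bar> \<le> exp t"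
      by (simp_all add: abs_mult mult_left_le)
    show "norm (Bt t s) \<le> C * exp t" "norm (Bs t s) \<le> C * exp t"
      unfolding Bt_def Bs_def by (intro combination_le le a1(2)[OF k] a2(2)[OF k])+
    define q where "q = polar p t s"
    define g where "g = w1 q + A q (w2 q)"
    have "Wt t s + B t s (Ws t s) = (exp t * cos s) *\<^sub>R g - (exp t * sin s) *\<^sub>R A q g"
      using A_A[OF q]
      by (simp add: Wt_def Ws_def B_def g_def q_def blinfun.add_right blinfun.diff_right
          blinfun.scaleR_right blinfun.minus_right algebra_simps)
    also have "norm \<dots> \<le> norm ((exp t * cos s) *\<^sub>R g) + norm ((exp t * sin s) *\<^sub>R A q g)"
      by (rule norm_triangle_ineq4)
    also have "\<dots> \<le> exp t * norm g + exp t * norm (A q g)"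
      unfolding norm_scaleR by (intro add_mono mult_right_mono le) auto
    also have "norm (A q g) \<le> a * norm g"
      using norm_blinfun[of "A q" g] mult_right_mono[OF a(2)[OF k], of "norm g"]
      by (simp add: q_def)
    also have "exp t * norm g + exp t * (a * norm g) = (1 + a) * exp t * norm g"
      by (simp add: algebra_simps)
    also have "norm g \<le> \<bar>L\<bar> * norm (W t s)"
      using L[OF k] mult_right_mono[OF abs_ge_self[of L], of "norm (W t s)"]
      by (simp add: g_def q_def W_def)
    also have "(1 + a) * exp t * (\<bar>L\<bar> * norm (W t s)) = (1 + a) * \<bar>L\<bar> * exp t * norm (W t s)"
      by simp
    also have "\<dots> \<le> C * exp t * norm (W t s)" by (intro mult_right_mono C) auto
    finally show "norm (Wt t s + B t s (Ws t s)) \<le> C * exp t * norm (W t s)"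
      using a(1) by simp
  next
    show "W t (2 * pi) = W t 0" "Wt t (2 * pi) = Wt t 0" "B t (2 * pi) = B t 0" for t
      by (simp_all add: W_def Wt_def B_def polar_def)
    show "continuous_on ({..<T} \<times> UNIV) (\<lambda>(t, s). W t s)"
      "continuous_on ({..<T} \<times> UNIV) (\<lambda>(t, s). Wt t s)"
      "continuous_on ({..<T} \<times> UNIV) (\<lambda>(t, s). Ws t s)"
      "continuous_on ({..<T} \<times> UNIV) (\<lambda>(t, s). Wst t s)"
      "continuous_on ({..<T} \<times> UNIV) (\<lambda>(t, s). B t s)"
      "continuous_on ({..<T} \<times> UNIV) (\<lambda>(t, s). Bt t s)"
      "continuous_on ({..<T} \<times> UNIV) (\<lambda>(t, s). Bs t s)"
      unfolding W_def Wt_def Ws_def Wst_def B_def Bt_def Bs_def case_prod_beta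
      by (intro continuous_intros conts[THEN cont])+
  qed
  have "\<exists>M t1. \<forall>t<t1. \<forall>s. norm (W t s) \<le> M * exp t ^ N" for N
  proof -
    obtain M d where "0 < d" and M: "\<And>y. dist y p < d \<Longrightarrow> norm (w y) \<le> M * dist p y ^ N"
      using flat[of N] unfolding eventually_nhds_metric by blast
    have "norm (W t s) \<le> M * exp t ^ N" if "t < ln d" for t s
    proof -
      have "exp t < exp (ln d)" using that by simp
      then have "dist (polar p t s) p < d" using \<open>0 < d\<close> by (simp add: dist_commute dist_polar)
      from M[OF this] show ?thesis by (simp add: W_def dist_polar)
    qed
    then show ?thesis by blast
  qed
  moreover have "ln (dist p x) < T" using False x R by (simp add: T_def)
  moreover obtain s where "s \<in> {0..2*pi}" "x = polar p (ln (dist p x)) s"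
    using polar_surj[OF False] by blast
  ultimately show ?thesis using flat_imp_zero by (metis W_def)
qed

text \<open>
  Let \<open>Z\<close> be the interior of the zero set. The function \<open>w\<close> is flat at every point of \<open>Z\<close>, hence vanishes on any
  disc in \<open>X\<close> with centre in \<open>Z\<close>. The radius of such discs is bounded below near a given point of \<open>X\<close>, so
  \<open>Z\<close> is relatively closed. It is open, and it is nonempty because \<open>w\<close> is flat at \<open>p0\<close>.
\<close>
theorem unique_continuation:
  fixes w :: "complex \<Rightarrow> 'b::euclidean_space" and A :: "complex \<Rightarrow> 'b \<Rightarrow>\<^sub>L 'b"
  assumes "open X" "connected X" "p0 \<in> X"
    and w: "has_partials_on w w1 w2 X" and w1: "has_partials_on w1 w11 w12 X"
    and w2: "has_partials_on w2 w21 w22 X" and A: "has_partials_on A A1 A2 X"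
    and A_A: "\<And>x y. x \<in> X \<Longrightarrow> A x (A x y) = - y"
    and L: "\<And>p R. cball p R \<subseteq> X \<Longrightarrow>
              \<exists>L. \<forall>x\<in>cball p R. norm (w1 x + A x (w2 x)) \<le> L * norm (w x)"
    and flat: "\<And>N::nat. \<exists>M. \<forall>\<^sub>F x in nhds p0. norm (w x) \<le> M * dist p0 x ^ N"
    and "x \<in> X"
  shows "w x = 0"
proof -
  define Z where "Z = interior {x \<in> X. w x = 0}"
  have disc: "ball p R \<subseteq> Z" if "cball p R \<subseteq> X"
    and flat_p: "\<And>N::nat. \<exists>M. \<forall>\<^sub>F x in nhds p. norm (w x) \<le> M * dist p x ^ N" for p R
  proof -
    obtain l where "\<And>x. x \<in> cball p R \<Longrightarrow> norm (w1 x + A x (w2 x)) \<le> l * norm (w x)"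
      using L[OF \<open>cball p R \<subseteq> X\<close>] by blast
    note l = this
    have "w y = 0" if "y \<in> ball p R" for y
      using unique_continuation_disc[OF \<open>cball p R \<subseteq> X\<close> w w1 w2 A A_A l flat_p that] by blast
    then show ?thesis
      unfolding Z_def using that(1) by (intro interior_maximal) auto
  qed
  have flat_Z: "\<exists>M. \<forall>\<^sub>F x in nhds p. norm (w x) \<le> M * dist p x ^ N" if "p \<in> Z" for p and N :: nat
  proof -
    have "\<forall>\<^sub>F x in nhds p. x \<in> Z"
      using that by (intro eventually_nhds_in_open) (auto simp: Z_def)
    then have "\<forall>\<^sub>F x in nhds p. norm (w x) \<le> 0 * dist p x ^ N"
      by eventually_elim (use interior_subset in \<open>auto simp: Z_def\<close>)
    then show ?thesis by blast
  qed
  have ZX: "Z \<subseteq> X" unfolding Z_def using interior_subset by blast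
  have "X \<subseteq> Z"
  proof (rule ccontr)
    assume "\<not> X \<subseteq> Z"
    have "open (X - Z)"
      unfolding open_contains_ball
    proof
      fix p assume p: "p \<in> X - Z"
      obtain r where r: "0 < r" "cball p r \<subseteq> X" using p \<open>open X\<close> open_contains_cball by blast
      \<comment> \<open>for \<open>q\<close> this close to \<open>p\<close>, the disc of radius \<open>r / 2\<close> around \<open>q\<close> contains \<open>p\<close> but stays inside \<open>X\<close>\<close>
      have "q \<notin> Z" if q: "q \<in> ball p (r / 3)" for q
      proof
        assume "q \<in> Z"
        have "cball q (r / 2) \<subseteq> cball p r"
          using q r(1) by (intro subsetI) (simp, smt (verit) dist_triangle field_sum_of_halves)
        then have "ball q (r / 2) \<subseteq> Z" using r(2) by (intro disc flat_Z \<open>q \<in> Z\<close>) auto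
        moreover have "p \<in> ball q (r / 2)" using q r(1) by (auto simp: dist_commute)
        ultimately show False using p by blast
      qed
      moreover have "ball p (r / 3) \<subseteq> X" using r by (auto simp: subset_iff)
      ultimately show "\<exists>e>0. ball p e \<subseteq> X - Z" using r(1) by (intro exI[of _ "r / 3"]) auto
    qed
    moreover have "open Z" by (simp add: Z_def)
    moreover have "Z \<inter> X \<noteq> {}"
    proof -
      obtain r where r: "0 < r" "cball p0 r \<subseteq> X"
        using \<open>p0 \<in> X\<close> \<open>open X\<close> open_contains_cball by blast
      have "ball p0 r \<subseteq> Z" by (rule disc[OF r(2) flat])
      then have "p0 \<in> Z" using r(1) by auto
      then show ?thesis using \<open>p0 \<in> X\<close> by blast
    qed
    ultimately show False
      using connectedD[OF \<open>connected X\<close>, of Z "X - Z"] \<open>\<not> X \<subseteq> Z\<close> by blast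
  qed
  then show ?thesis using \<open>x \<in> X\<close> interior_subset unfolding Z_def by blast
qed

section \<open>Reduction of the nonlinear equation\<close>

lemma C_diff_on_imp_continuous_on: "C_diff_on k f S \<Longrightarrow> continuous_on S f"
  by (cases k) (auto intro!: continuous_at_imp_continuous_on differentiable_imp_continuous_within)

lemma C_diff_on_imp_has_partials_on:
  assumes "C_diff_on (Suc k) f S"
  shows "has_partials_on f (\<lambda>x. frechet_derivative f (at x) 1) (\<lambda>x. frechet_derivative f (at x) \<i>) S"
  unfolding has_partials_on_def
proof (intro conjI ballI)
  fix x assume "x \<in> S"
  then have D: "(f has_derivative frechet_derivative f (at x)) (at x)"
    using assms frechet_derivative_works by auto
  then interpret linear "frechet_derivative f (at x)"
    using has_derivative_bounded_linear bounded_linear.linear by blast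
  have "frechet_derivative f (at x) h =
      Re h *\<^sub>R frechet_derivative f (at x) 1 + Im h *\<^sub>R frechet_derivative f (at x) \<i>" for h
  proof -
    have "h = Re h *\<^sub>R 1 + Im h *\<^sub>R \<i>" by (simp add: complex_eq_iff)
    then show ?thesis by (metis add scale)
  qed
  then show "(f has_derivative (\<lambda>h. Re h *\<^sub>R frechet_derivative f (at x) 1
      + Im h *\<^sub>R frechet_derivative f (at x) \<i>)) (at x)"
    using D by (metis (no_types, lifting) ext)
qed (use assms in \<open>auto intro: C_diff_on_imp_continuous_on[of k]\<close>)

lemma has_partials_on_diff:
  assumes "has_partials_on f f1 f2 X" and "has_partials_on g g1 g2 X"
  shows "has_partials_on (\<lambda>x. f x - g x) (\<lambda>x. f1 x - g1 x) (\<lambda>x. f2 x - g2 x) X"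
  using assms unfolding has_partials_on_def
  by (auto intro!: continuous_intros derivative_eq_intros simp: algebra_simps)

lemma smooth_on_imp_partials:
  assumes "smooth_on f X"
  obtains f1 f2 f11 f12 f21 f22 where "has_partials_on f f1 f2 X"
    "has_partials_on f1 f11 f12 X" "has_partials_on f2 f21 f22 X"
proof -
  have "C_diff_on (Suc (Suc 0)) f X" using assms smooth_on_def by blast
  then have "C_diff_on (Suc 0) (\<lambda>x. frechet_derivative f (at x) h) X" for h by simp
  then show thesis
    using that C_diff_on_imp_has_partials_on[OF \<open>C_diff_on (Suc (Suc 0)) f X\<close>]
      C_diff_on_imp_has_partials_on by blast
qed

lemma frechet_derivative_eq_sum_Basis:
  fixes f :: "'a::euclidean_space \<Rightarrow> 'b::real_normed_vector"
  assumes "f differentiable at q"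
  shows "frechet_derivative f (at q) k = (\<Sum>b\<in>Basis. (k \<bullet> b) *\<^sub>R frechet_derivative f (at q) b)"
proof -
  interpret linear "frechet_derivative f (at q)"
    using assms frechet_derivative_works has_derivative_bounded_linear bounded_linear.linear by blast
  have "frechet_derivative f (at q) (\<Sum>b\<in>Basis. (k \<bullet> b) *\<^sub>R b)
      = (\<Sum>b\<in>Basis. (k \<bullet> b) *\<^sub>R frechet_derivative f (at q) b)"
    by (simp add: sum scale)
  then show ?thesis by (simp add: euclidean_representation)
qed

lemma has_partials_on_compose_C1:
  fixes F :: "'a::euclidean_space \<Rightarrow> 'b::real_normed_vector"
  assumes F: "C_diff_on (Suc 0) F UNIV" and u: "has_partials_on u u1 u2 X"
  shows "has_partials_on (\<lambda>x. F (u x)) (\<lambda>x. frechet_derivative F (at (u x)) (u1 x))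
           (\<lambda>x. frechet_derivative F (at (u x)) (u2 x)) X"
proof -
  have diff: "F differentiable at q" for q using F by simp
  have "continuous_on UNIV (\<lambda>q. frechet_derivative F (at q) b)" for b
    using F by simp
  then have cont: "continuous_on X (\<lambda>x. frechet_derivative F (at (u x)) b)" for b
    by (rule continuous_on_compose2[OF _ has_partials_on_imp_continuous_on[OF u]]) auto
  have cont': "continuous_on X (\<lambda>x. frechet_derivative F (at (u x)) (g x))"
    if "continuous_on X g" for g
    by (subst frechet_derivative_eq_sum_Basis[OF diff]) (intro continuous_intros that cont)
  have "((\<lambda>x. F (u x)) has_derivative (\<lambda>h. Re h *\<^sub>R frechet_derivative F (at (u x)) (u1 x)
      + Im h *\<^sub>R frechet_derivative F (at (u x)) (u2 x))) (at x)" if "x \<in> X" for x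
  proof -
    have D: "(F has_derivative frechet_derivative F (at (u x))) (at (u x))"
      using diff frechet_derivative_works by blast
    then interpret linear "frechet_derivative F (at (u x))"
      using has_derivative_bounded_linear bounded_linear.linear by blast
    have "(u has_derivative (\<lambda>h. Re h *\<^sub>R u1 x + Im h *\<^sub>R u2 x)) (at x)"
      using u that by (simp add: has_partials_on_def)
    from has_derivative_compose[OF this D] show ?thesis by (simp add: add scale)
  qed
  then show ?thesis
    using u cont' by (auto simp: has_partials_on_def)
qed

lemma C1_imp_Lipschitz_on_cball:
  fixes F :: "'a::euclidean_space \<Rightarrow> 'b::real_normed_vector"
  assumes F: "C_diff_on (Suc 0) F UNIV"
  shows "\<exists>M. \<forall>a\<in>cball c \<rho>. \<forall>b\<in>cball c \<rho>. norm (F a - F b) \<le> M * norm (a - b)"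
proof -
  have diff: "F differentiable at q" for q using F by simp
  have "\<exists>m. \<forall>q\<in>cball c \<rho>. norm (frechet_derivative F (at q) b) \<le> m" for b
  proof -
    have "continuous_on UNIV (\<lambda>q. frechet_derivative F (at q) b)" using F by simp
    then have "compact ((\<lambda>q. frechet_derivative F (at q) b) ` cball c \<rho>)"
      by (intro compact_continuous_image[OF continuous_on_subset[OF _ subset_UNIV]] compact_cball)
    then have "bounded ((\<lambda>q. frechet_derivative F (at q) b) ` cball c \<rho>)" by (rule compact_imp_bounded)
    then show ?thesis by (auto simp: bounded_iff)
  qed
  then obtain m where m: "\<And>b q. q \<in> cball c \<rho> \<Longrightarrow> norm (frechet_derivative F (at q) b) \<le> m b"
    by metis
  have onorm_le: "onorm (frechet_derivative F (at q)) \<le> (\<Sum>b\<in>Basis. m b)" if "q \<in> cball c \<rho>" for q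
  proof (rule onorm_bound)
    show "0 \<le> (\<Sum>b\<in>Basis. m b)"
      using m[OF that] norm_ge_zero order_trans by (intro sum_nonneg) blast
    fix k
    have "norm (frechet_derivative F (at q) k) \<le>
        (\<Sum>b\<in>Basis. norm ((k \<bullet> b) *\<^sub>R frechet_derivative F (at q) b))"
      unfolding frechet_derivative_eq_sum_Basis[OF diff, of q k] by (rule norm_sum)
    also have "\<dots> \<le> (\<Sum>b\<in>Basis. norm k * m b)"
      unfolding norm_scaleR
      by (intro sum_mono mult_mono Basis_le_norm m that) auto
    finally show "norm (frechet_derivative F (at q) k) \<le> (\<Sum>b\<in>Basis. m b) * norm k"
      by (simp add: sum_distrib_left[symmetric] mult.commute)
  qed
  have "norm (F a - F b) \<le> (\<Sum>b\<in>Basis. m b) * norm (a - b)"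
    if "a \<in> cball c \<rho>" "b \<in> cball c \<rho>" for a b
  proof (rule differentiable_bound[of "cball c \<rho>" F "\<lambda>q. frechet_derivative F (at q)"])
    show "(F has_derivative frechet_derivative F (at q)) (at q within cball c \<rho>)" for q
      using diff[of q] by (simp add: frechet_derivative_works has_derivative_at_withinI)
  qed (use that onorm_le in auto)
  then show ?thesis by blast
qed

text \<open>
  Matrices as operators with the operator norm, so that the results on operator-valued coefficients apply.
\<close>
definition act_blinfun :: "real ^ ('n::finite + 'n) ^ ('n + 'n) \<Rightarrow> (complex ^ 'n) \<Rightarrow>\<^sub>L (complex ^ 'n)" where
  "act_blinfun M = Blinfun (real_matrix_act M)"

lemma act_blinfun_apply [simp]: "act_blinfun M y = real_matrix_act M y"
proof -
  have "linear (real_matrix_act M)"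
    by (rule linearI)
      (auto simp: real_matrix_act_def of_real_vec_def to_real_vec_def matrix_vector_mult_def
        vec_eq_iff complex_eq_iff sum.distrib[symmetric] sum_distrib_left
        intro!: sum.cong split: sum.split simp: algebra_simps)
  then show ?thesis
    unfolding act_blinfun_def by (simp add: bounded_linear_Blinfun_apply linear_linear)
qed

lemma bounded_linear_act_blinfun: "bounded_linear act_blinfun"
  unfolding linear_conv_bounded_linear[symmetric]
  by (rule linearI; rule blinfun_eqI)
    (auto simp: real_matrix_act_def of_real_vec_def to_real_vec_def matrix_vector_mult_def
        vec_eq_iff complex_eq_iff blinfun.add_left blinfun.scaleR_left
        sum.distrib[symmetric] sum_distrib_left algebra_simps
        intro!: sum.cong split: sum.split)

lemma real_matrix_act_square:
  assumes "M ** M = - mat 1"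
  shows "real_matrix_act M (real_matrix_act M y) = - y"
proof -
  have "M *v (M *v x) = - x" for x
    using assms matrix_vector_mult_diff_rdistrib[of 0 "mat 1" x]
    by (simp add: matrix_vector_mul_assoc)
  then have "real_matrix_act M (real_matrix_act M y) = of_real_vec (- to_real_vec y)"
    by (simp add: real_matrix_act_def)
  also have "\<dots> = - y"
    by (simp add: of_real_vec_def to_real_vec_def vec_eq_iff complex_eq_iff)
  finally show ?thesis .
qed

lemma C_diff_on_bounded_linear_compose:
  assumes \<Lambda>: "bounded_linear \<Lambda>" and F: "C_diff_on (Suc 0) F UNIV"
  shows "C_diff_on (Suc 0) (\<lambda>p. \<Lambda> (F p)) UNIV"
proof -
  have D: "((\<lambda>p. \<Lambda> (F p)) has_derivative (\<lambda>h. \<Lambda> (frechet_derivative F (at q) h))) (at q)" for q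
    using F frechet_derivative_works
    by (intro bounded_linear.has_derivative[OF \<Lambda>]) auto
  then have "frechet_derivative (\<lambda>p. \<Lambda> (F p)) (at q) = (\<lambda>h. \<Lambda> (frechet_derivative F (at q) h))" for q
    by (metis frechet_derivative_at)
  then show ?thesis
    using D F by (auto simp: differentiable_def intro!: bounded_linear.continuous_on[OF \<Lambda>])
qed

theorem theorem1:
  fixes X :: "complex set"
    and J :: "complex ^ 'n::finite \<Rightarrow> real ^ ('n + 'n) ^ ('n + 'n)"
    and u v :: "complex \<Rightarrow> complex ^ 'n"
  assumes "open X" and "connected X" and "0 \<in> X"
    and "\<And>p. invertible (J p)"
    and "C_diff_on 1 J UNIV"
    and "\<And>p. J p ** J p = - mat 1"
    and "smooth_on u X" and "smooth_on v X"
    and "\<And>x. x \<in> X \<Longrightarrow> partial_x1 u x + real_matrix_act (J (u x)) (partial_x2 u x) = 0"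
    and "\<And>x. x \<in> X \<Longrightarrow> partial_x1 v x + real_matrix_act (J (v x)) (partial_x2 v x) = 0"
    and "vanishes_to_infinite_order_at_0 (\<lambda>x. u x - v x)"
  shows "\<forall>x\<in>X. u x = v x"
proof
  fix x assume "x \<in> X"
  obtain u1 u2 u11 u12 u21 u22 where u: "has_partials_on u u1 u2 X"
    and u1: "has_partials_on u1 u11 u12 X" and u2: "has_partials_on u2 u21 u22 X"
    using smooth_on_imp_partials[OF \<open>smooth_on u X\<close>] .
  obtain v1 v2 v11 v12 v21 v22 where v: "has_partials_on v v1 v2 X"
    and v1: "has_partials_on v1 v11 v12 X" and v2: "has_partials_on v2 v21 v22 X"
    using smooth_on_imp_partials[OF \<open>smooth_on v X\<close>] .
  define F where "F p = act_blinfun (J p)" for p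
  have F: "C_diff_on (Suc 0) F UNIV"
    unfolding F_def
    using C_diff_on_bounded_linear_compose[OF bounded_linear_act_blinfun] \<open>C_diff_on 1 J UNIV\<close> by simp
  have u_eq: "u1 x + F (u x) (u2 x) = 0" and v_eq: "v1 x + F (v x) (v2 x) = 0" if "x \<in> X" for x
    using that assms(9,10) u v by (simp_all add: F_def partial_x1_eq partial_x2_eq)
  have "u x - v x = 0"
  proof (rule unique_continuation[OF \<open>open X\<close> \<open>connected X\<close> \<open>0 \<in> X\<close> has_partials_on_diff[OF u v]
        has_partials_on_diff[OF u1 v1] has_partials_on_diff[OF u2 v2]
        has_partials_on_compose_C1[OF F u] _ _ _ \<open>x \<in> X\<close>])
    show "F (u x) (F (u x) y) = - y" for x y
      using real_matrix_act_square[OF assms(6)] by (simp add: F_def)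
    show "\<exists>M. \<forall>\<^sub>F x in nhds 0. norm (u x - v x) \<le> M * dist 0 x ^ N" for N :: nat
      using assms(11) by (simp add: vanishes_to_infinite_order_at_0_def)
  next
    fix p R assume "cball p R \<subseteq> X"
    have bounded: "\<exists>M. \<forall>x\<in>cball p R. norm (f x) \<le> M" if "continuous_on X f"
      for f :: "complex \<Rightarrow> complex ^ 'n"
    proof -
      have "compact (f ` cball p R)"
        using continuous_on_subset[OF that \<open>cball p R \<subseteq> X\<close>] by (intro compact_continuous_image) auto
      then have "bounded (f ` cball p R)" by (rule compact_imp_bounded)
      then show ?thesis by (auto simp: bounded_iff)
    qed
    obtain \<rho>u \<rho>v k where \<rho>: "\<And>x. x \<in> cball p R \<Longrightarrow> norm (u x) \<le> \<rho>u"
      "\<And>x. x \<in> cball p R \<Longrightarrow> norm (v x) \<le> \<rho>v"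
      and k: "\<And>x. x \<in> cball p R \<Longrightarrow> norm (v2 x) \<le> k"
      using bounded[OF has_partials_on_imp_continuous_on[OF u]]
        bounded[OF has_partials_on_imp_continuous_on[OF v]]
        bounded[OF has_partials_on_imp_continuous_on[OF v2]] by metis
    obtain M where "\<forall>a\<in>cball 0 (max \<rho>u \<rho>v). \<forall>b\<in>cball 0 (max \<rho>u \<rho>v). norm (F a - F b) \<le> M * norm (a - b)"
      using C1_imp_Lipschitz_on_cball[OF F] by blast
    then have M: "norm (F a - F b) \<le> M * norm (a - b)"
      if "norm a \<le> max \<rho>u \<rho>v" "norm b \<le> max \<rho>u \<rho>v" for a b
      using that by simp
    \<comment> \<open>subtracting the equations leaves \<open>(F (v x) - F (u x)) (v2 x)\<close>, and \<open>F\<close> is Lipschitz\<close>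
    have "norm (u1 x - v1 x + F (u x) (u2 x - v2 x)) \<le> k * M * norm (u x - v x)"
      if x: "x \<in> cball p R" for x
    proof -
      have "u1 x - v1 x + F (u x) (u2 x - v2 x) = (F (v x) - F (u x)) (v2 x)"
        using u_eq[of x] v_eq[of x] x \<open>cball p R \<subseteq> X\<close>
        by (auto simp: blinfun.diff_right blinfun.diff_left algebra_simps add_eq_0_iff)
      also have "norm \<dots> \<le> norm (F (v x) - F (u x)) * norm (v2 x)" by (rule norm_blinfun)
      also have "\<dots> \<le> M * norm (u x - v x) * k"
      proof (rule mult_mono)
        show Fle: "norm (F (v x) - F (u x)) \<le> M * norm (u x - v x)"
          using M[of "v x" "u x"] \<rho>[OF x] by (simp add: norm_minus_commute)
        show "0 \<le> M * norm (u x - v x)" using Fle norm_ge_zero order_trans by blast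
      qed (use k[OF x] in auto)
      finally show ?thesis by (simp add: mult_ac)
    qed
    then show "\<exists>L. \<forall>x\<in>cball p R. norm (u1 x - v1 x + F (u x) (u2 x - v2 x)) \<le> L * norm (u x - v x)"
      by blast
  qed
  then show "u x = v x" by simp
qed

end
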